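(* Let $p$ be a prime, let $\mathbb{F}$ be either a finite field $\mathbb{F}_q$ ($q$ a power of $p$) or $\overline{\mathbb{F}}_p$, and let $K=\mathbb{F}((t))$. Let $L/K$ be a near one-dimensional elementary abelian extension of degree $p^{n+1}$ ($n\ge 0$), given by data $x_0,\dots,x_n$, $\beta$, $b$, $\Omega_0,\dots,\Omega_n$, $\epsilon_0,\dots,\epsilon_n$ as in the context, with $G=\mathrm{Gal}(L/K)$, elements $\sigma_i\in G$ and $\Theta_{(0)},\dots,\Theta_{(n)}\in K[G]$ as defined in the context. For $1\le i\le n$ let $m_i=v_K(\Omega_{i-1})-v_K(\Omega_i)$, and for $0\le j\le n$ choose any $\alpha_j\in K$ with $$v_K(\alpha_j)=p^{n-j-1}\sum_{i=j+1}^{n}p^i m_i .$$ Let $b_m$ be the largest lower ramification break number of $L/K$. Then for every $\rho\in L$ with $v_L(\rho)\equiv b_m \pmod{p^{n+1}}$ and all $a_0,\dots,a_n\in\{0,1,\dots,p-1\}$, $$v_L\Big(\prod_{s=0}^{n}\alpha_{n-s}^{a_s}(\Theta_{(s)}-1)^{a_s}\,\rho\Big)=v_L(\rho)+\sum_{s=0}^{n}a_s p^s b_m .$$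
   Context: Notation: $v_K$, $v_L$ are the normalized additive valuations of $K$ and $L$; $\mathfrak O_K=\{x: v_K(x)\ge 0\}$, $\mathfrak P_K$ its maximal ideal; $\wp(x)=x^p-x$ and $\phi(x)=x^p$. Lower ramification groups: $G_i=\{\sigma\in G: v_L(\sigma\pi_L-\pi_L)\ge i+1\}$ for a prime $\pi_L$ of $L$; a lower break number is an $i$ with $G_i\ne G_{i+1}$. Definition: a fully ramified Galois extension $L/K$ of degree $p^{n+1}$ is a near one-dimensional elementary abelian extension if $L=K(x_0,\dots,x_n)$ with $x_i^p-x_i=\phi^n(\Omega_i)\beta+\epsilon_i$ ($0\le i\le n$), where: $\beta\in K$, $v_K(\beta)=-b$, $b>0$, $\gcd(b,p)=1$; $\Omega_0,\dots,\Omega_n\in K$ are linearly independent over $\mathbb{F}_p$, $\Omega_0=1$, and $v_K(\Omega_n)\le\cdots\le v_K(\Omega_1)\le v_K(\Omega_0)=0$; whenever $v_K(\Omega_i)=\cdots=v_K(\Omega_j)$ with $i<j$, the images of $\phi^n(\Omega_i)\beta,\dots,\phi^n(\Omega_j)\beta$ in $\phi^n(\Omega_i)\beta\mathfrak O_K/\phi^n(\Omega_i)\beta\mathfrak P_K$ are linearly independent over $\mathbb{F}_p$; $\epsilon_0=0$ and, with $m_j=v_K(\Omega_{j-1})-v_K(\Omega_j)$, for $1\le i\le n$ the $\epsilon_i\in K$ satisfy $$v_K(\epsilon_i)>-\frac{b}{p^n}-\sum_{j=1}^{i}p^jm_j+\sum_{j=i+1}^{n}(p^n-p^j)m_j .$$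 (One-dimensional means additionally all $\epsilon_i=0$.) Galois elements: $\sigma_i\in G$ is the element with $\sigma_i x_i=x_i+1$ and $\sigma_i x_j=x_j$ for $j\ne i$. Matrices: set $\Omega_j^{(0)}=\Omega_j$ and recursively, for $1\le i\le j\le n$, $\Omega_j^{(i)}=\wp(\Omega_j^{(i-1)})/\wp(\Omega_i^{(i-1)})$ (so $\Omega_j^{(j)}=1$). Let $[\Omega^\phi]$ be the $(n+1)\times(n+1)$ upper triangular matrix (indices $0\le i,j\le n$) with entries $\phi^{n-i-1}(\Omega_j^{(i)})$ for $j\ge i$ and $0$ for $j<i$ (the only entry with $\phi^{-1}$ is the $(n,n)$ entry, equal to $1$). Let $[\Delta_{i,j}]=[\Omega^\phi]^{-1}$. Truncated exponentiation: for $\theta\in K[G]$ with $\theta-1$ in the augmentation ideal and $c\in K$, $\theta^{[c]}=\sum_{k=0}^{p-1}\binom{c}{k}(\theta-1)^k$, where $\binom{c}{k}=c(c-1)\cdots(c-k+1)/k!$. Define recursively $\Theta_{(0)}=\sigma_n$ and, for $1\le i\le n$, $$\Theta_{(i)}=\sigma_{n-i}\,\Theta_{(0)}^{[-\Delta_{n-i,n}]}\Theta_{(1)}^{[-\Delta_{n-i,n-1}]}\cdots\Theta_{(i-1)}^{[-\Delta_{n-i,n-(i-1)}]}\in K[G].$$ *)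

theory Defs
  imports
    "HOL-Computational_Algebra.Computational_Algebra"
    "HOL-Number_Theory.Cong"
    "HOL-Library.Poly_Mapping"
    "Jordan_Normal_Form.Gauss_Jordan_Elimination"
begin

section \<open>Coefficient fields and the local field of Laurent series\<close>

definition is_finite_field_of_char :: "nat \<Rightarrow> 'k::field itself \<Rightarrow> bool" where
  "is_finite_field_of_char p _ \<longleftrightarrow> CHAR('k) = p \<and> finite (UNIV :: 'k set)"

text \<open>
  An algebraic closure of the field with $p$ elements: algebraically closed, and algebraic over its
  prime subfield, which for positive characteristic is \<^term>\<open>range of_int\<close>.
\<close>

definition is_Fp_bar :: "nat \<Rightarrow> 'k::field itself \<Rightarrow> bool" where
  "is_Fp_bar p _ \<longleftrightarrow>
     CHAR('k) = p \<and>
     (\<forall>P :: 'k poly. degree P > 0 \<longrightarrow> (\<exists>z. poly P z = 0)) \<and>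
     (\<forall>z :: 'k. \<exists>P :: 'k poly. P \<noteq> 0 \<and> (\<forall>i. coeff P i \<in> range of_int) \<and> poly P z = 0)"

text \<open>
  The field $K$ is \<^typ>\<open>'k fls\<close>, with valuation \<^const>\<open>fls_subdegree\<close>.  All valuations are
  \<^typ>\<open>int\<close>-valued, and their value at 0 carries no meaning: the element 0, whose valuation is
  infinite, is treated separately wherever it can occur.
\<close>

definition max_ideal_K :: "'k::field fls set" where
  "max_ideal_K = {z. z = 0 \<or> fls_subdegree z \<ge> 1}"

definition wp :: "nat \<Rightarrow> 'a::field \<Rightarrow> 'a" where
  "wp p z = z ^ p - z"

definition frob :: "nat \<Rightarrow> 'a::field \<Rightarrow> 'a" where
  "frob p z = z ^ p"

text \<open>
  Linear independence over the field with $p$ elements (the integers modulo $p$) of the classes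
  of the family \<open>f\<close> in the quotient by the additive subgroup \<open>M\<close>.
\<close>

definition Fp_independent_mod ::
    "nat \<Rightarrow> 'a::field set \<Rightarrow> nat set \<Rightarrow> (nat \<Rightarrow> 'a) \<Rightarrow> bool" where
  "Fp_independent_mod p M I f \<longleftrightarrow>
     (\<forall>c :: nat \<Rightarrow> int. (\<Sum>i\<in>I. of_int (c i) * f i) \<in> M \<longrightarrow> (\<forall>i\<in>I. int p dvd c i))"


section \<open>The group of field automorphisms\<close>

typedef (overloaded) ('l::field) field_auto = "{\<sigma> :: 'l \<Rightarrow> 'l. field_hom \<sigma> \<and> bij \<sigma>}"
  morphisms app Abs_field_auto
proof
  have "field_hom (id :: 'l \<Rightarrow> 'l)" by unfold_locales auto
  then show "id \<in> {\<sigma> :: 'l \<Rightarrow> 'l. field_hom \<sigma> \<and> bij \<sigma>}" by simp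
qed

text \<open>
  The group is written additively (\<open>+\<close> is composition, \<open>0\<close> the identity; it is not commutative
  in general), because the monoid algebra \<^typ>\<open>'g \<Rightarrow>\<^sub>0 'a\<close> of \<^theory>\<open>HOL-Library.Poly_Mapping\<close>
  is set up for additive monoids.
\<close>

instantiation field_auto :: (field) group_add
begin

definition zero_field_auto :: "'a field_auto" where
  "0 = Abs_field_auto id"

definition plus_field_auto :: "'a field_auto \<Rightarrow> 'a field_auto \<Rightarrow> 'a field_auto" where
  "\<sigma> + \<tau> = Abs_field_auto (app \<sigma> \<circ> app \<tau>)"

definition uminus_field_auto :: "'a field_auto \<Rightarrow> 'a field_auto" where
  "- \<sigma> = Abs_field_auto (inv_into UNIV (app \<sigma>))"

definition minus_field_auto :: "'a field_auto \<Rightarrow> 'a field_auto \<Rightarrow> 'a field_auto" where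
  "\<sigma> - \<tau> = \<sigma> + - (\<tau> :: 'a field_auto)"

instance
proof
  have hom: "field_hom (app \<sigma>)" and bij: "bij (app \<sigma>)" for \<sigma> :: "'a field_auto"
    using app[of \<sigma>] by auto
  have zero: "app (0 :: 'a field_auto) = id"
  proof -
    have "field_hom (id :: 'a \<Rightarrow> 'a)" by unfold_locales auto
    then show ?thesis by (simp add: zero_field_auto_def Abs_field_auto_inverse)
  qed
  have plus: "app (\<sigma> + \<tau>) = app \<sigma> \<circ> app \<tau>" for \<sigma> \<tau> :: "'a field_auto"
  proof -
    interpret s: field_hom "app \<sigma>" by (rule hom)
    interpret t: field_hom "app \<tau>" by (rule hom)
    have "field_hom (app \<sigma> \<circ> app \<tau>)"
      by unfold_locales (auto simp: s.hom_add t.hom_add s.hom_mult t.hom_mult)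
    then show ?thesis
      using bij_comp[OF bij bij] by (simp add: plus_field_auto_def Abs_field_auto_inverse)
  qed
  have uminus: "app (- \<sigma>) = inv_into UNIV (app \<sigma>)" for \<sigma> :: "'a field_auto"
  proof -
    interpret s: field_hom "app \<sigma>" by (rule hom)
    have surj: "app \<sigma> (inv_into UNIV (app \<sigma>) y) = y" for y
      by (rule surj_f_inv_f[OF bij_is_surj[OF bij]])
    have inj: "inv_into UNIV (app \<sigma>) y = x \<longleftrightarrow> y = app \<sigma> x" for x y
      using surj inv_f_f[OF bij_is_inj[OF bij]] by metis
    have "field_hom (inv_into UNIV (app \<sigma>))"
      by unfold_locales (simp_all add: inj surj s.hom_add s.hom_mult)
    then show ?thesis
      using bij_imp_bij_inv[OF bij] by (simp add: uminus_field_auto_def Abs_field_auto_inverse)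
  qed
  fix a b c :: "'a field_auto"
  show "a + b + c = a + (b + c)"
    by (simp add: app_inject[symmetric] plus comp_assoc)
  show "0 + a = a" "a + 0 = a"
    by (simp_all add: app_inject[symmetric] plus zero)
  show "- a + a = 0"
    using bij_is_inj[OF bij] by (simp add: app_inject[symmetric] plus zero uminus)
  show "a + - b = a - b"
    by (simp add: minus_field_auto_def)
qed

end


section \<open>Totally ramified Galois extensions of the local field\<close>

text \<open>An extension $L/K$ is given by the type of $L$ and an embedding \<open>\<iota>\<close> of $K$ into it.\<close>

definition galois_group :: "('k::field fls \<Rightarrow> 'l::field) \<Rightarrow> 'l field_auto set" where
  "galois_group \<iota> = {\<sigma>. \<forall>c. app \<sigma> (\<iota> c) = \<iota> c}"

text \<open>The degree is 0 if the extension is infinite.\<close>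

definition ext_degree :: "('k::field fls \<Rightarrow> 'l::field) \<Rightarrow> nat" where
  "ext_degree \<iota> = vector_space.dim (\<lambda>c z. \<iota> c * z) (UNIV :: 'l set)"

definition finite_galois :: "('k::field fls \<Rightarrow> 'l::field) \<Rightarrow> bool" where
  "finite_galois \<iota> \<longleftrightarrow>
     ext_degree \<iota> > 0 \<and> {z. \<forall>\<sigma>\<in>galois_group \<iota>. app \<sigma> z = z} = range \<iota>"

definition is_subfield :: "'l::field set \<Rightarrow> bool" where
  "is_subfield F \<longleftrightarrow> 0 \<in> F \<and> 1 \<in> F \<and>
     (\<forall>y\<in>F. \<forall>z\<in>F. y - z \<in> F \<and> y * z \<in> F) \<and> (\<forall>z\<in>F. inverse z \<in> F)"

definition adjoin :: "('k::field fls \<Rightarrow> 'l::field) \<Rightarrow> 'l set \<Rightarrow> 'l set" where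
  "adjoin \<iota> S = \<Inter>{F. is_subfield F \<and> range \<iota> \<subseteq> F \<and> S \<subseteq> F}"

definition normalized_valuation :: "('l::field \<Rightarrow> int) \<Rightarrow> bool" where
  "normalized_valuation v \<longleftrightarrow>
     (\<forall>y z. y \<noteq> 0 \<longrightarrow> z \<noteq> 0 \<longrightarrow> v (y * z) = v y + v z) \<and>
     (\<forall>y z. y \<noteq> 0 \<longrightarrow> z \<noteq> 0 \<longrightarrow> y + z \<noteq> 0 \<longrightarrow> v (y + z) \<ge> min (v y) (v z)) \<and>
     v ` (- {0}) = UNIV"

text \<open>
  The normalized valuation of $L$ extends the one of $K$ up to the factor $e(L/K)$, the
  ramification index; fully ramified means that $e(L/K) = [L:K]$.
\<close>

definition fully_ramified :: "('k::field fls \<Rightarrow> 'l::field) \<Rightarrow> ('l \<Rightarrow> int) \<Rightarrow> bool" where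
  "fully_ramified \<iota> vL \<longleftrightarrow>
     normalized_valuation vL \<and>
     (\<forall>c. c \<noteq> 0 \<longrightarrow> vL (\<iota> c) = int (ext_degree \<iota>) * fls_subdegree c)"

definition is_uniformizer :: "('l::field \<Rightarrow> int) \<Rightarrow> 'l \<Rightarrow> bool" where
  "is_uniformizer v \<pi> \<longleftrightarrow> \<pi> \<noteq> 0 \<and> v \<pi> = 1"

definition lower_ramification_group ::
    "('k::field fls \<Rightarrow> 'l::field) \<Rightarrow> ('l \<Rightarrow> int) \<Rightarrow> 'l \<Rightarrow> int \<Rightarrow> 'l field_auto set" where
  "lower_ramification_group \<iota> vL \<pi> i =
     {\<sigma> \<in> galois_group \<iota>. app \<sigma> \<pi> - \<pi> = 0 \<or> vL (app \<sigma> \<pi> - \<pi>) \<ge> i + 1}"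

definition is_lower_break ::
    "('k::field fls \<Rightarrow> 'l::field) \<Rightarrow> ('l \<Rightarrow> int) \<Rightarrow> 'l \<Rightarrow> int \<Rightarrow> bool" where
  "is_lower_break \<iota> vL \<pi> i \<longleftrightarrow>
     lower_ramification_group \<iota> vL \<pi> i \<noteq> lower_ramification_group \<iota> vL \<pi> (i + 1)"

definition is_largest_lower_break ::
    "('k::field fls \<Rightarrow> 'l::field) \<Rightarrow> ('l \<Rightarrow> int) \<Rightarrow> 'l \<Rightarrow> int \<Rightarrow> bool" where
  "is_largest_lower_break \<iota> vL \<pi> bm \<longleftrightarrow>
     is_lower_break \<iota> vL \<pi> bm \<and> (\<forall>i. is_lower_break \<iota> vL \<pi> i \<longrightarrow> i \<le> bm)"


section \<open>Near one-dimensional elementary abelian extensions\<close>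

definition m_gap :: "(nat \<Rightarrow> 'k::field fls) \<Rightarrow> nat \<Rightarrow> int" where
  "m_gap \<Omega> j = fls_subdegree (\<Omega> (j - 1)) - fls_subdegree (\<Omega> j)"

locale near_one_dimensional =
  fixes p n :: nat
    and \<iota> :: "'k::field fls \<Rightarrow> 'l::field"
    and vL :: "'l \<Rightarrow> int"
    and x :: "nat \<Rightarrow> 'l"
    and \<beta> :: "'k fls"
    and b :: int
    and \<Omega> \<epsilon> :: "nat \<Rightarrow> 'k fls"
  assumes embedding: "field_hom \<iota>"
    and galois: "finite_galois \<iota>"
    and degree: "ext_degree \<iota> = p ^ (n + 1)"
    and fully_ramified: "fully_ramified \<iota> vL"
    and generators: "adjoin \<iota> (x ` {0..n}) = UNIV"
    and artin_schreier:
      "\<And>i. i \<le> n \<Longrightarrow> x i ^ p - x i = \<iota> ((frob p ^^ n) (\<Omega> i) * \<beta> + \<epsilon> i)"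
    and beta_nonzero: "\<beta> \<noteq> 0"
    and beta_valuation: "fls_subdegree \<beta> = - b"
    and b_pos: "b > 0"
    and b_coprime: "coprime b (int p)"
    and Omega_independent: "Fp_independent_mod p {0} {0..n} \<Omega>"
    and Omega_0: "\<Omega> 0 = 1"
    and Omega_decreasing:
      "\<And>i. i < n \<Longrightarrow> fls_subdegree (\<Omega> (Suc i)) \<le> fls_subdegree (\<Omega> i)"
    and leading_terms_independent:
      "\<And>i j. i < j \<Longrightarrow> j \<le> n \<Longrightarrow>
         (\<And>k. k \<in> {i..j} \<Longrightarrow> fls_subdegree (\<Omega> k) = fls_subdegree (\<Omega> i)) \<Longrightarrow>
         Fp_independent_mod p {(frob p ^^ n) (\<Omega> i) * \<beta> * z | z. z \<in> max_ideal_K} {i..j}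
           (\<lambda>k. (frob p ^^ n) (\<Omega> k) * \<beta>)"
    and eps_0: "\<epsilon> 0 = 0"
    and eps_bound:
      "\<And>i. 1 \<le> i \<Longrightarrow> i \<le> n \<Longrightarrow> \<epsilon> i \<noteq> 0 \<Longrightarrow>
         real_of_int (fls_subdegree (\<epsilon> i)) >
           - (real_of_int b / real p ^ n)
           - (\<Sum>j=1..i. real p ^ j * real_of_int (m_gap \<Omega> j))
           + (\<Sum>j=i+1..n. (real p ^ n - real p ^ j) * real_of_int (m_gap \<Omega> j))"


section \<open>The elements of the group algebra\<close>

text \<open>\<open>Omega_iter p \<Omega> i j\<close> is $\Omega_j^{(i)}$.\<close>

fun Omega_iter :: "nat \<Rightarrow> (nat \<Rightarrow> 'a::field) \<Rightarrow> nat \<Rightarrow> nat \<Rightarrow> 'a" where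
  "Omega_iter p \<Omega> 0 j = \<Omega> j"
| "Omega_iter p \<Omega> (Suc i) j =
     wp p (Omega_iter p \<Omega> i j) / wp p (Omega_iter p \<Omega> i (Suc i))"

text \<open>The $(n,n)$ entry, formally $\phi^{-1}(\Omega_n^{(n)}) = \phi^{-1}(1)$, is 1.\<close>

definition Omega_phi :: "nat \<Rightarrow> nat \<Rightarrow> (nat \<Rightarrow> 'a::field) \<Rightarrow> 'a mat" where
  "Omega_phi p n \<Omega> = mat (n + 1) (n + 1)
     (\<lambda>(i, j). if j < i then 0 else if i = n then 1
               else (frob p ^^ (n - i - 1)) (Omega_iter p \<Omega> i j))"

definition Delta :: "nat \<Rightarrow> nat \<Rightarrow> (nat \<Rightarrow> 'a::field) \<Rightarrow> nat \<Rightarrow> nat \<Rightarrow> 'a" where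
  "Delta p n \<Omega> i j = index_mat (the (mat_inverse (Omega_phi p n \<Omega>))) (i, j)"

text \<open>
  The group algebra $K[G]$ is the subalgebra of \<^typ>\<open>'l field_auto \<Rightarrow>\<^sub>0 'k fls\<close> of elements whose
  support lies in \<^const>\<open>galois_group\<close>.  The scalar $c$ is \<open>Poly_Mapping.single 0 c\<close>, where \<open>0\<close> is
  the identity automorphism, and the automorphism $\sigma$ is \<open>Poly_Mapping.single \<sigma> 1\<close>.
\<close>

abbreviation scalar :: "'a \<Rightarrow> ('g::zero \<Rightarrow>\<^sub>0 'a::zero)" where
  "scalar c \<equiv> Poly_Mapping.single 0 c"

abbreviation group_elem :: "'g \<Rightarrow> ('g \<Rightarrow>\<^sub>0 'a::zero_neq_one)" where
  "group_elem \<sigma> \<equiv> Poly_Mapping.single \<sigma> 1"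

definition act ::
    "('k::field fls \<Rightarrow> 'l::field) \<Rightarrow> ('l field_auto \<Rightarrow>\<^sub>0 'k fls) \<Rightarrow> 'l \<Rightarrow> 'l" where
  "act \<iota> \<theta> z = (\<Sum>\<sigma>\<in>Poly_Mapping.keys \<theta>. \<iota> (Poly_Mapping.lookup \<theta> \<sigma>) * app \<sigma> z)"

text \<open>
  The binomial coefficient is only used for \<open>k < p\<close>, where $k!$ is invertible; \<^const>\<open>gbinomial\<close> is
  restricted to characteristic 0.
\<close>

definition binom :: "'a::field \<Rightarrow> nat \<Rightarrow> 'a" where
  "binom c k = (\<Prod>i<k. c - of_nat i) / of_nat (fact k)"

definition trunc_exp ::
    "nat \<Rightarrow> ('g::monoid_add \<Rightarrow>\<^sub>0 'a::field) \<Rightarrow> 'a \<Rightarrow> ('g \<Rightarrow>\<^sub>0 'a)" where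
  "trunc_exp p \<theta> c = (\<Sum>k<p. scalar (binom c k) * (\<theta> - 1) ^ k)"

text \<open>
  For \<open>i = 0\<close> the list is empty and \<open>Theta p n \<Omega> \<sigma> 0\<close> is $\sigma_n$.  Products in the group algebra
  are taken in the order in which they are written.
\<close>

fun Theta :: "nat \<Rightarrow> nat \<Rightarrow> (nat \<Rightarrow> 'a::field) \<Rightarrow> (nat \<Rightarrow> 'g::monoid_add) \<Rightarrow> nat \<Rightarrow> ('g \<Rightarrow>\<^sub>0 'a)" where
  "Theta p n \<Omega> \<sigma> i =
     group_elem (\<sigma> (n - i)) *
     prod_list (map (\<lambda>s. trunc_exp p (Theta p n \<Omega> \<sigma> s) (- Delta p n \<Omega> (n - i) (n - s))) [0..<i])"

declare Theta.simps [simp del]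

end

theory Submission
  imports Defs "Jordan_Normal_Form.Determinant"
begin

text \<open>
  The matrix \<open>[\<Omega>\<^sup>\<phi>]\<close> replaces the generators \<open>x\<^sub>j\<close> by \<open>X\<^sub>j\<close> with \<open>(x\<^sub>0, \<dots>, x\<^sub>n) = (X\<^sub>0, \<dots>, X\<^sub>n) [\<Omega>\<^sup>\<phi>]\<close>.
  They satisfy \<open>\<wp>(X\<^sub>j\<^sub>+\<^sub>1) = - c\<^sub>j X\<^sub>j + E\<^sub>j\<^sub>+\<^sub>1\<close> with \<open>c\<^sub>j, E\<^sub>j\<^sub>+\<^sub>1 \<in> K\<close> and \<open>E\<^sub>j\<^sub>+\<^sub>1\<close> negligible, so that
  \<open>v\<^sub>L(X\<^sub>j) = - p\<^bsup>n-j\<^esup> b\<^sub>j\<close> for integers \<open>b\<^sub>j \<equiv> b\<close> modulo \<open>p\<^bsup>n+1\<^esup>\<close>, and \<open>b\<^sub>n\<close> is the largest lower break.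
  Products of powers of the \<open>X\<^sub>j\<close>, or of binomial coefficients \<open>binom X\<^sub>j e\<^sub>j\<close>, with exponents below \<open>p\<close>
  have valuations that are pairwise incongruent modulo \<open>[L : K]\<close>; hence they form a basis of \<open>L\<close> over
  \<open>K\<close>, and the valuation of a linear combination is the minimum of the valuations of its terms.
  Since \<open>\<sigma>\<^sub>i X\<^sub>j = X\<^sub>j + \<Delta>\<^sub>i\<^sub>,\<^sub>j\<close>, Vandermonde's identity shows that the truncated powers in \<open>\<Theta>\<^bsub>(s)\<^esub>\<close> undo all
  the shifts by \<open>\<sigma>\<^bsub>n-s\<^esub>\<close> except \<open>X\<^bsub>n-s\<^esub> \<mapsto> X\<^bsub>n-s\<^esub> + 1\<close>.  So \<open>\<Theta>\<^bsub>(s)\<^esub> - 1\<close> lowers the exponent \<open>e\<^bsub>n-s\<^esub>\<close> of a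
  binomial basis vector by one, and the factor \<open>\<alpha>\<^bsub>n-s\<^esub>\<close> makes the gain in valuation equal to \<open>p\<^sup>s b\<^sub>n\<close>.
  The congruence on \<open>\<rho>\<close> forces its leading basis vector to have all exponents equal to \<open>p - 1\<close>, so it
  survives every operator in the theorem.
\<close>

section \<open>Valuations\<close>

locale valued_field =
  fixes v :: "'a::field \<Rightarrow> int"
  assumes v_mult: "y \<noteq> 0 \<Longrightarrow> z \<noteq> 0 \<Longrightarrow> v (y * z) = v y + v z"
    and v_add: "y \<noteq> 0 \<Longrightarrow> z \<noteq> 0 \<Longrightarrow> y + z \<noteq> 0 \<Longrightarrow> v (y + z) \<ge> min (v y) (v z)"
begin

lemma v_one: "v 1 = 0"
  using v_mult[of 1 1] by simp

lemma v_power: "z \<noteq> 0 \<Longrightarrow> v (z ^ k) = int k * v z"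
  by (induction k) (auto simp: v_one v_mult algebra_simps)

text \<open>Gives valuation 0 to -1 (with \<open>q\<close> = 3) and to nonzero elements of the prime
  field (with \<open>q\<close> = p).\<close>

lemma v_fixed_power:
  assumes "z ^ q = z" "z \<noteq> 0" "q > 1"
  shows "v z = 0"
proof -
  have "int q * v z = v z"
    using v_power[OF assms(2), of q] assms(1) by simp
  then have "(int q - 1) * v z = 0"
    by (simp add: algebra_simps)
  then show ?thesis
    using assms(3) by simp
qed

lemma v_uminus: "v (- z) = v z"
proof (cases "z = 0")
  case False
  have "v (- 1) = 0"
    by (rule v_fixed_power[of _ 3]) (auto simp: power3_eq_cube)
  then show ?thesis
    using v_mult[of "- 1" z] False by simp
qed simp

lemma v_inverse: "z \<noteq> 0 \<Longrightarrow> v (inverse z) = - v z"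
  using v_mult[of z "inverse z"] by (simp add: v_one)

lemma v_divide: "y \<noteq> 0 \<Longrightarrow> z \<noteq> 0 \<Longrightarrow> v (y / z) = v y - v z"
  by (simp add: divide_inverse v_mult v_inverse)

lemma v_prod: "(\<And>i. i \<in> I \<Longrightarrow> f i \<noteq> 0) \<Longrightarrow> v (\<Prod>i\<in>I. f i) = (\<Sum>i\<in>I. v (f i))"
  by (induction I rule: infinite_finite_induct) (auto simp: v_one v_mult)

text \<open>A fractional ideal. The element 0 is put in by hand, because \<open>v 0\<close> is an
  arbitrary integer.\<close>

definition vge :: "int \<Rightarrow> 'a set" where
  "vge k = {z. z = 0 \<or> v z \<ge> k}"

lemma vge_0 [simp]: "0 \<in> vge k"
  by (simp add: vge_def)

lemma vge_self: "z \<in> vge (v z)"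
  by (simp add: vge_def)

lemma vge_mono: "z \<in> vge k \<Longrightarrow> l \<le> k \<Longrightarrow> z \<in> vge l"
  by (auto simp: vge_def)

lemma vge_add: "y \<in> vge k \<Longrightarrow> z \<in> vge k \<Longrightarrow> y + z \<in> vge k"
  using v_add[of y z] by (cases "y = 0 \<or> z = 0 \<or> y + z = 0") (auto simp: vge_def)

lemma vge_uminus: "z \<in> vge k \<Longrightarrow> - z \<in> vge k"
  by (auto simp: vge_def v_uminus)

lemma vge_diff: "y \<in> vge k \<Longrightarrow> z \<in> vge k \<Longrightarrow> y - z \<in> vge k"
  using vge_add[OF _ vge_uminus, of y k z] by simp

lemma vge_sum: "(\<And>i. i \<in> I \<Longrightarrow> f i \<in> vge k) \<Longrightarrow> (\<Sum>i\<in>I. f i) \<in> vge k"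
  by (induction I rule: infinite_finite_induct) (auto intro: vge_add)

lemma vge_mult: "y \<in> vge k \<Longrightarrow> z \<in> vge l \<Longrightarrow> y * z \<in> vge (k + l)"
  by (cases "y = 0 \<or> z = 0") (auto simp: vge_def v_mult)

lemma vge_power:
  assumes "z \<in> vge k"
  shows "z ^ e \<in> vge (int e * k)"
proof (induction e)
  case 0
  then show ?case
    using vge_self[of 1] by (simp add: v_one)
next
  case (Suc e)
  then show ?case
    using vge_mult[of z k "z ^ e" "int e * k"] assms by (simp add: algebra_simps)
qed

lemma v_add_dominant:
  assumes "y \<noteq> 0" "z \<in> vge k" "v y < k"
  shows "y + z \<noteq> 0" "v (y + z) = v y"
proof -
  show nz: "y + z \<noteq> 0"
  proof
    assume "y + z = 0"
    then have "z = - y"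
      by (simp add: eq_neg_iff_add_eq_0 add.commute)
    then show False
      using assms by (auto simp: vge_def v_uminus)
  qed
  show "v (y + z) = v y"
  proof (cases "z = 0")
    case False
    then have z: "v y < v z"
      using assms by (auto simp: vge_def)
    moreover have "v (y + z) \<ge> min (v y) (v z)"
      using v_add assms(1) False nz by blast
    moreover have "v (y + z + - z) \<ge> min (v (y + z)) (v (- z))"
      using assms(1) False nz by (intro v_add) auto
    ultimately show ?thesis
      by (simp add: v_uminus min_def split: if_splits)
  qed simp
qed

text \<open>For an element with a pole, \<open>z ^ q\<close> has strictly smaller valuation than
  \<open>z\<close> and decides that of \<open>wp q z\<close>.\<close>

lemma v_wp_neg:
  assumes "z \<noteq> 0" "v z < 0" "q > 1"
  shows "wp q z \<noteq> 0" "v (wp q z) = int q * v z"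
proof -
  have "v (z ^ q) < v z"
    using assms by (simp add: v_power)
  then show "wp q z \<noteq> 0" "v (wp q z) = int q * v z"
    using v_add_dominant[of "z ^ q" "- z" "v z"] vge_uminus[OF vge_self[of z]] assms
    by (simp_all add: wp_def v_power)
qed

lemma wp_vge_0: "z \<in> vge 0 \<Longrightarrow> wp q z \<in> vge 0"
  unfolding wp_def using vge_power[of z 0 q] by (simp add: vge_diff)

lemma v_from_wp_neg:
  assumes "wp q z \<noteq> 0" "v (wp q z) < 0" "q > 1"
  shows "z \<noteq> 0" "v z < 0" "int q * v z = v (wp q z)"
proof -
  have "z \<notin> vge 0"
    using wp_vge_0[of z q] assms by (auto simp: vge_def)
  then show "z \<noteq> 0" "v z < 0"
    by (auto simp: vge_def)
  then show "int q * v z = v (wp q z)"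
    using v_wp_neg(2) assms(3) by simp
qed

lemma v_from_wp_nonpos:
  assumes "wp q z \<noteq> 0" "v (wp q z) \<le> 0" "q > 1"
  shows "z \<noteq> 0" "v z \<le> 0"
proof -
  show z: "z \<noteq> 0"
    using assms by (auto simp: wp_def)
  show "v z \<le> 0"
  \<comment> \<open>If \<open>v z > 0\<close>, the term \<open>- z\<close> dominates and
    \<open>wp q z\<close> has positive valuation as well.\<close>
  proof (rule ccontr)
    assume "\<not> v z \<le> 0"
    moreover from this have "v z < v (z ^ q)"
      using assms z by (simp add: v_power)
    then have "v (- z + z ^ q) = v z"
      using v_add_dominant(2)[of "- z" "z ^ q" "v (z ^ q)"] z vge_self[of "z ^ q"]
      by (simp add: v_uminus)
    ultimately show False
      using assms by (simp add: wp_def)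
  qed
qed

section \<open>Sums with a unique term of least valuation\<close>

lemma sum_dominant:
  assumes "finite I" "i \<in> I" "f i \<noteq> 0"
    and "\<And>j. j \<in> I \<Longrightarrow> j \<noteq> i \<Longrightarrow> f j \<noteq> 0 \<Longrightarrow> v (f i) < v (f j)"
  shows "(\<Sum>j\<in>I. f j) \<noteq> 0" "v (\<Sum>j\<in>I. f j) = v (f i)"
proof -
  have "(\<Sum>j\<in>I - {i}. f j) \<in> vge (v (f i) + 1)"
    using assms(4) by (intro vge_sum) (force simp: vge_def)
  moreover have "(\<Sum>j\<in>I. f j) = f i + (\<Sum>j\<in>I - {i}. f j)"
    using assms by (simp add: sum.remove)
  ultimately show "(\<Sum>j\<in>I. f j) \<noteq> 0" "v (\<Sum>j\<in>I. f j) = v (f i)"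
    using v_add_dominant[of "f i" _ "v (f i) + 1"] assms(3) by simp_all
qed

text \<open>Injectivity is required on the indices of nonzero terms, where the valuation has a
  meaning; the nonzero term of least valuation is then unique.\<close>

lemma sum_distinct_valuations:
  assumes "finite I" "i \<in> I" "f i \<noteq> 0"
    and inj: "inj_on (\<lambda>j. v (f j)) {j \<in> I. f j \<noteq> 0}"
  obtains m where "m \<in> I" "f m \<noteq> 0" "(\<Sum>j\<in>I. f j) \<noteq> 0" "v (\<Sum>j\<in>I. f j) = v (f m)"
    "\<And>j. j \<in> I \<Longrightarrow> j \<noteq> m \<Longrightarrow> f j \<noteq> 0 \<Longrightarrow> v (f m) < v (f j)"
proof -
  let ?S = "{j \<in> I. f j \<noteq> 0}"
  have S: "finite ?S" "?S \<noteq> {}"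
    using assms by auto
  obtain m where m: "m \<in> ?S" "\<And>j. j \<in> ?S \<Longrightarrow> v (f m) \<le> v (f j)"
    using ex_is_arg_min_if_finite[OF S, of "\<lambda>j. v (f j)"]
    by (auto simp: is_arg_min_linorder)
  have less: "v (f m) < v (f j)" if "j \<in> I" "j \<noteq> m" "f j \<noteq> 0" for j
  proof -
    have "v (f m) \<noteq> v (f j)"
      using inj_onD[OF inj, of m j] that m(1) by auto
    then show ?thesis
      using m(2)[of j] that by simp
  qed
  show ?thesis
    using that[of m] m(1) less sum_dominant[of I m f] assms(1) by auto
qed

section \<open>Principal units and first-order expansion of powers\<close>

definition principal_units :: "int \<Rightarrow> 'a set" where
  "principal_units k = {u. u - 1 \<in> vge k}"

lemma principal_units_one: "1 \<in> principal_units k"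
  by (simp add: principal_units_def)

lemma principal_units_mult:
  assumes "y \<in> principal_units k" "z \<in> principal_units k" "k \<ge> 0"
  shows "y * z \<in> principal_units k"
proof -
  have "(y - 1) * (z - 1) \<in> vge k"
    using vge_mono[OF vge_mult[of "y - 1" k "z - 1" k], of k] assms by (simp add: principal_units_def)
  then have "(y - 1) * (z - 1) + (y - 1) + (z - 1) \<in> vge k"
    using assms by (intro vge_add) (simp_all add: principal_units_def)
  then show ?thesis
    by (simp add: principal_units_def algebra_simps)
qed

lemma principal_units_prod:
  "(\<And>i. i \<in> I \<Longrightarrow> f i \<in> principal_units k) \<Longrightarrow> k \<ge> 0 \<Longrightarrow> (\<Prod>i\<in>I. f i) \<in> principal_units k"
  by (induction I rule: infinite_finite_induct) (auto intro: principal_units_mult principal_units_one)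

lemma of_nat_vge_0: "of_nat e \<in> vge 0"
  by (induction e) (auto intro!: vge_add simp: vge_self[of 1, unfolded v_one])

text \<open>The terms beyond first order contain \<open>y * y\<close>, whose valuation is at least
  \<open>2 * k\<close> and hence at least \<open>k + 1\<close>.\<close>

lemma power_one_plus:
  assumes "y \<in> vge k" "k \<ge> 1"
  shows "(1 + y) ^ e - 1 - of_nat e * y \<in> vge (k + 1)"
proof (induction e)
  case (Suc e)
  have y: "1 + y \<in> vge 0"
    using vge_add[OF vge_self[of 1] vge_mono[OF assms(1)]] assms(2) by (simp add: v_one)
  have "y * y \<in> vge (k + 1)"
    using vge_mono[OF vge_mult[OF assms(1,1)]] assms(2) by simp
  then have "of_nat e * (y * y) \<in> vge (k + 1)"
    using vge_mult[OF of_nat_vge_0] by fastforce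
  moreover have "(1 + y) * ((1 + y) ^ e - 1 - of_nat e * y) \<in> vge (k + 1)"
    using vge_mult[OF y Suc] by simp
  ultimately have "of_nat e * (y * y) + (1 + y) * ((1 + y) ^ e - 1 - of_nat e * y) \<in> vge (k + 1)"
    by (rule vge_add)
  then show ?case
    by (simp add: algebra_simps)
qed simp

end

interpretation fls: valued_field "fls_subdegree :: 'k::field fls \<Rightarrow> int"
proof
  fix y z :: "'k fls"
  show "min (fls_subdegree y) (fls_subdegree z) \<le> fls_subdegree (y + z)" if "y + z \<noteq> 0"
    using fls_plus_subdegree[OF that] .
qed simp

section \<open>Characteristic \<open>p\<close>\<close>

lemma frob_funpow: "(frob q ^^ k) z = z ^ (q ^ k)"
  by (induction k) (auto simp: frob_def power_mult[symmetric] mult.commute)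

locale char_p_field =
  fixes p :: nat and ty :: "'a::field itself"
  assumes prime_p: "prime p" and CHAR_p: "CHAR('a) = p"
begin

lemma p_gt_1: "p > 1"
  using prime_p prime_gt_1_nat by simp

lemma add_power_p: "(y + z :: 'a) ^ p = y ^ p + z ^ p"
  using freshmans_dream[where 'a = 'a] prime_p CHAR_p by simp

lemma uminus_power_p: "(- z :: 'a) ^ p = - (z ^ p)"
proof -
  have "(z + - z) ^ p = z ^ p + (- z) ^ p"
    by (rule add_power_p)
  then show ?thesis
    using p_gt_1 by (simp add: eq_neg_iff_add_eq_0 add.commute zero_power)
qed

lemma diff_power_p: "(y - z :: 'a) ^ p = y ^ p - z ^ p"
  using add_power_p[of y "- z"] by (simp add: uminus_power_p)

lemma wp_add: "wp p (y + z :: 'a) = wp p y + wp p z"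
  by (simp add: wp_def add_power_p)

lemma wp_diff: "wp p (y - z :: 'a) = wp p y - wp p z"
  by (simp add: wp_def diff_power_p)

lemma wp_0: "wp p (0 :: 'a) = 0"
  using p_gt_1 by (simp add: wp_def zero_power)

lemma wp_sum: "wp p (\<Sum>i\<in>I. f i :: 'a) = (\<Sum>i\<in>I. wp p (f i))"
  by (induction I rule: infinite_finite_induct) (auto simp: wp_add wp_0)

lemma of_nat_power_p: "(of_nat k :: 'a) ^ p = of_nat k"
  using p_gt_1 by (induction k) (auto simp: add_power_p zero_power)

lemma of_int_power_p: "(of_int k :: 'a) ^ p = of_int k"
  by (cases k rule: int_cases2) (simp_all add: of_nat_power_p uminus_power_p)

lemma of_int_eq_0_iff_dvd: "(of_int k :: 'a) = 0 \<longleftrightarrow> int p dvd k"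
  using of_int_eq_0_iff_char_dvd[where 'a = 'a, of k] CHAR_p by simp

lemma wp_of_int_mult: "wp p (of_int k * z :: 'a) = of_int k * wp p z"
  by (simp add: wp_def power_mult_distrib of_int_power_p algebra_simps)

lemma sum_power_p_pow: "(\<Sum>i\<in>I. f i :: 'a) ^ (p ^ k) = (\<Sum>i\<in>I. f i ^ (p ^ k))"
  using freshmans_dream_sum'[where 'a = 'a] prime_p CHAR_p by metis

lemma of_int_power_p_pow: "(of_int c :: 'a) ^ (p ^ k) = of_int c"
  by (induction k) (auto simp: power_mult of_int_power_p)

lemma inj_on_of_nat: "inj_on (of_nat :: nat \<Rightarrow> 'a) {..<p}"
proof (rule inj_onI)
  fix i j assume ij: "i \<in> {..<p}" "j \<in> {..<p}" "(of_nat i :: 'a) = of_nat j"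
  then have "(of_int (int i - int j) :: 'a) = 0"
    by simp
  then have "int p dvd int i - int j"
    by (simp only: of_int_eq_0_iff_dvd)
  then have "[int i = int j] (mod int p)"
    by (simp add: cong_iff_dvd_diff)
  then show "i = j"
    using ij by (simp add: cong_def flip: of_nat_mod)
qed

text \<open>Both sides come from monic polynomials of degree p vanishing on the prime field; their
  difference has degree below p and p roots. The factorization gives the valuation of
  \<open>wp p z\<close> even when \<open>z\<close> is a unit and neither term of \<open>wp\<close>
  dominates.\<close>

lemma wp_eq_prod: "wp p (z :: 'a) = (\<Prod>d<p. z - of_nat d)"
proof -
  define P :: "'a poly" where "P = monom 1 p + [:0, -1:]"
  define Q :: "'a poly" where "Q = (\<Prod>d<p. [:- of_nat d, 1:])"
  have degQ: "degree Q = p"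
    unfolding Q_def by (subst degree_prod_eq_sum_degree) auto
  have lcQ: "lead_coeff Q = 1"
    unfolding Q_def by (simp add: lead_coeff_prod)
  have cP: "coeff P p = 1"
    using p_gt_1 by (auto simp: P_def coeff_pCons split: nat.splits)
  have degP: "degree P \<le> p"
    using p_gt_1 by (auto simp: P_def intro!: degree_add_le degree_monom_le)
  have "P - Q = 0"
  proof (rule ccontr)
    assume ne: "P - Q \<noteq> 0"
    have "degree (P - Q) \<noteq> p"
      using ne cP lcQ degQ by (metis coeff_diff diff_self leading_coeff_0_iff)
    then have deg: "degree (P - Q) < p"
      using degree_diff_le[OF degP, of Q] degQ by simp
    have "of_nat ` {..<p} \<subseteq> {x. poly (P - Q) x = 0}"
      by (auto simp: P_def Q_def poly_monom of_nat_power_p poly_prod)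
    then have "card (of_nat ` {..<p} :: 'a set) \<le> card {x. poly (P - Q) x = 0}"
      by (rule card_mono[OF poly_roots_finite[OF ne]])
    then have "p \<le> card {x. poly (P - Q) x = 0}"
      by (simp add: card_image[OF inj_on_of_nat])
    also have "\<dots> \<le> degree (P - Q)"
      using card_poly_roots_bound[OF ne] .
    finally show False
      using deg by simp
  qed
  then have "poly P z = poly Q z"
    by simp
  then show ?thesis
    by (simp add: P_def Q_def wp_def poly_monom poly_prod)
qed

end

declare Omega_iter.simps [simp del]

section \<open>Near one-dimensional extensions\<close>

locale near_one_dim = near_one_dimensional p n \<iota> vL x \<beta> b \<Omega> \<epsilon>
  for p n :: nat
    and \<iota> :: "'k::field fls \<Rightarrow> 'l::field"
    and vL :: "'l \<Rightarrow> int"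
    and x :: "nat \<Rightarrow> 'l"
    and \<beta> :: "'k fls"
    and b :: int
    and \<Omega> \<epsilon> :: "nat \<Rightarrow> 'k fls" +
  assumes prime: "prime p" and CHAR_k: "CHAR('k) = p"
begin

sublocale hom: field_hom \<iota>
  by (rule embedding)

sublocale K: char_p_field p "TYPE('k fls)"
  by unfold_locales (simp_all add: prime CHAR_k)

lemma CHAR_l: "CHAR('l) = p"
proof (rule CHAR_eqI)
  have "of_nat p = (0 :: 'k fls)"
    using of_nat_CHAR[where 'a = "'k fls"] CHAR_k by simp
  then show "of_nat p = (0 :: 'l)"
    using hom.hom_of_nat[of p] by simp
  fix m assume "of_nat m = (0 :: 'l)"
  then have "\<iota> (of_nat m) = 0"
    by (simp add: hom.hom_of_nat)
  then have "of_nat m = (0 :: 'k fls)"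
    by simp
  then show "p dvd m"
    using of_nat_eq_0_iff_char_dvd[where 'a = "'k fls", of m] CHAR_k by simp
qed

sublocale L: char_p_field p "TYPE('l)"
  by unfold_locales (simp_all add: prime CHAR_l)

sublocale vL: valued_field vL
  using fully_ramified by unfold_locales (auto simp: fully_ramified_def normalized_valuation_def)

lemma vL_\<iota>: "c \<noteq> 0 \<Longrightarrow> vL (\<iota> c) = int p ^ (n + 1) * fls_subdegree c"
  using fully_ramified degree by (auto simp: fully_ramified_def)

abbreviation vK :: "'k fls \<Rightarrow> int" where "vK \<equiv> fls_subdegree"

abbreviation \<omega> :: "nat \<Rightarrow> nat \<Rightarrow> 'k fls" where "\<omega> \<equiv> Omega_iter p \<Omega>"

section \<open>Valuations of the iterated elements \<open>\<omega> i j\<close>\<close>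

lemma Omega_nonzero: "j \<le> n \<Longrightarrow> \<Omega> j \<noteq> 0"
proof
  assume j: "j \<le> n" "\<Omega> j = 0"
  define c :: "nat \<Rightarrow> int" where "c = (\<lambda>k. if k = j then 1 else 0)"
  have "(\<Sum>i\<in>{0..n}. of_int (c i) * \<Omega> i) \<in> {0}"
    using j by (auto simp: c_def intro!: sum.neutral)
  then have "\<forall>i\<in>{0..n}. int p dvd c i"
    using Omega_independent unfolding Fp_independent_mod_def by blast
  then show False
    using j K.p_gt_1 by (auto simp: c_def dest: bspec[of _ _ j])
qed

lemma Omega_antimono: "i \<le> j \<Longrightarrow> j \<le> n \<Longrightarrow> vK (\<Omega> j) \<le> vK (\<Omega> i)"
proof (induction j rule: dec_induct)
  case (step j)
  then show ?case
    using Omega_decreasing[of j] by simp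
qed simp

lemma of_int_mult_vge: "k \<le> vK z \<Longrightarrow> of_int c * z \<in> fls.vge k"
  by (cases "of_int c = (0 :: 'k fls)"; cases "z = 0") (simp_all add: fls.vge_def)

text \<open>Raising to the power p^n and multiplying by \<beta> is linear over the prime field. This
  carries the independence of leading terms over to the \<open>\<Omega> k\<close> themselves: those
  of least valuation do not cancel, and the others have larger valuation.\<close>

lemma Omega_combination:
  assumes "j \<le> n" "\<not> int p dvd c j"
  shows "(\<Sum>k=0..j. of_int (c k) * \<Omega> k) \<noteq> 0"
    and "vK (\<Sum>k=0..j. of_int (c k) * \<Omega> k) = vK (\<Omega> j)"
proof -
  \<comment> \<open>By monotonicity, \<open>{i..j}\<close> is exactly the block of indices up to
    \<open>j\<close> that share the valuation of \<open>\<Omega> j\<close>.\<close>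
  define i where "i = (LEAST k. vK (\<Omega> k) = vK (\<Omega> j))"
  have vi: "vK (\<Omega> i) = vK (\<Omega> j)" and ij: "i \<le> j"
    unfolding i_def by (rule LeastI[of _ j], rule refl) (rule Least_le, rule refl)
  have v_eq: "vK (\<Omega> k) = vK (\<Omega> i)" if "k \<in> {i..j}" for k
    using Omega_antimono[of i k] Omega_antimono[of k j] that assms(1) vi by auto
  have v_less: "vK (\<Omega> j) < vK (\<Omega> k)" if "k < i" for k
    using not_less_Least[of k "\<lambda>k. vK (\<Omega> k) = vK (\<Omega> j)"] Omega_antimono[of k j] that ij assms(1)
    by (auto simp: i_def[symmetric])
  define s where "s = (\<Sum>k=i..j. of_int (c k) * \<Omega> k)"
  define r where "r = (\<Sum>k\<in>{0..<i}. of_int (c k) * \<Omega> k)"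
  have s: "s \<noteq> 0 \<and> vK s = vK (\<Omega> j)"
  proof (cases "i = j")
    \<comment> \<open>\<open>leading_terms_independent\<close> speaks of blocks with at least two
      elements; a single term cannot cancel.\<close>
    case True
    then have "s = of_int (c j) * \<Omega> j"
      by (simp add: s_def)
    then show ?thesis
      using assms Omega_nonzero[of j] by (simp add: K.of_int_eq_0_iff_dvd)
  next
    case False
    define u where "u = \<Omega> i ^ (p ^ n) * \<beta>"
    have u: "u \<noteq> 0"
      using Omega_nonzero[of i] ij assms(1) beta_nonzero by (simp add: u_def)
    have ind: "Fp_independent_mod p {u * z | z. z \<in> max_ideal_K} {i..j} (\<lambda>k. \<Omega> k ^ (p ^ n) * \<beta>)"
    proof -
      have "i < j"
        using False ij by simp
      from leading_terms_independent[OF this assms(1) v_eq] show ?thesis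
        by (simp add: frob_funpow u_def)
    qed
    have comb: "(\<Sum>k\<in>{i..j}. of_int (c k) * (\<Omega> k ^ (p ^ n) * \<beta>)) = s ^ (p ^ n) * \<beta>"
      by (simp add: s_def K.sum_power_p_pow power_mult_distrib K.of_int_power_p_pow
          sum_distrib_right mult.assoc)
    have nin: "s ^ (p ^ n) * \<beta> \<notin> {u * z | z. z \<in> max_ideal_K}"
    proof
      assume "s ^ (p ^ n) * \<beta> \<in> {u * z | z. z \<in> max_ideal_K}"
      then have "\<forall>k\<in>{i..j}. int p dvd c k"
        using ind[unfolded Fp_independent_mod_def, rule_format, of c] unfolding comb by blast
      then show False
        using assms(2) ij by simp
    qed
    have s0: "s \<noteq> 0"
    proof
      assume "s = 0"
      then have "s ^ (p ^ n) * \<beta> = u * 0"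
        using K.p_gt_1 by (simp add: power_0_left)
      moreover have "(0 :: 'k fls) \<in> max_ideal_K"
        by (simp add: max_ideal_K_def)
      ultimately show False
        using nin by blast
    qed
    have "\<not> vK (s ^ (p ^ n) * \<beta> / u) \<ge> 1"
    proof
      assume "vK (s ^ (p ^ n) * \<beta> / u) \<ge> 1"
      then have "s ^ (p ^ n) * \<beta> / u \<in> max_ideal_K"
        by (simp add: max_ideal_K_def)
      moreover have "s ^ (p ^ n) * \<beta> = u * (s ^ (p ^ n) * \<beta> / u)"
        using u by simp
      ultimately show False
        using nin by blast
    qed
    then have "int (p ^ n) * vK s \<le> int (p ^ n) * vK (\<Omega> i)"
      using s0 u beta_nonzero Omega_nonzero[of i] ij assms(1)
      by (simp add: fls.v_divide fls_subdegree_pow u_def)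
    then have "vK s \<le> vK (\<Omega> i)"
      using K.p_gt_1 by simp
    moreover have "s \<in> fls.vge (vK (\<Omega> i))"
      unfolding s_def
      by (intro fls.vge_sum of_int_mult_vge) (simp only: v_eq order_refl)
    ultimately show ?thesis
      using s0 vi by (auto simp: fls.vge_def)
  qed
  have "r \<in> fls.vge (vK (\<Omega> j) + 1)"
    unfolding r_def
  proof (intro fls.vge_sum of_int_mult_vge)
    fix k assume "k \<in> {0..<i}"
    then show "vK (\<Omega> j) + 1 \<le> vK (\<Omega> k)"
      using v_less[of k] by simp
  qed
  moreover have "(\<Sum>k=0..j. of_int (c k) * \<Omega> k) = s + r"
    unfolding s_def r_def using ij
    by (subst sum.union_disjoint[symmetric]) (auto intro!: sum.cong)
  ultimately show "(\<Sum>k=0..j. of_int (c k) * \<Omega> k) \<noteq> 0"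
    and "vK (\<Sum>k=0..j. of_int (c k) * \<Omega> k) = vK (\<Omega> j)"
    using s fls.v_add_dominant[of s r "vK (\<Omega> j) + 1"] by simp_all
qed

text \<open>The invariant of the induction in \<open>omega_aux\<close>: leading terms of equal
  valuation stay independent over the prime field. Sums end at \<open>j\<close> because valuations
  weakly decrease with the index, so that the last term has the least one.\<close>

definition residually_independent :: "nat \<Rightarrow> bool" where
  "residually_independent i \<longleftrightarrow> (\<forall>j c. i \<le> j \<longrightarrow> j \<le> n \<longrightarrow> \<not> int p dvd c j \<longrightarrow>
     (\<Sum>k=i..j. of_int (c k) * \<omega> i k) \<noteq> 0 \<and>
     vK (\<Sum>k=i..j. of_int (c k) * \<omega> i k) = vK (\<omega> i j))"

text \<open>By \<open>K.wp_eq_prod\<close>, \<open>wp p\<close> of the sum is the product of its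
  translates by elements d of the prime field. Each translate is again a combination, with
  coefficient -d on \<open>\<omega> i i = 1\<close>, so all factors have the same valuation.\<close>

lemma wp_omega_combination:
  assumes "residually_independent i" "\<omega> i i = 1" "i < j" "j \<le> n" "\<not> int p dvd c j"
  shows "wp p (\<Sum>k=Suc i..j. of_int (c k) * \<omega> i k) \<noteq> 0"
    and "vK (wp p (\<Sum>k=Suc i..j. of_int (c k) * \<omega> i k)) = int p * vK (\<omega> i j)"
proof -
  let ?z = "\<Sum>k=Suc i..j. of_int (c k) * \<omega> i k"
  have "?z - of_nat d \<noteq> 0 \<and> vK (?z - of_nat d) = vK (\<omega> i j)" for d
  proof -
    define c' where "c' = c(i := - int d)"
    have "(\<Sum>k=i..j. of_int (c' k) * \<omega> i k) = of_int (c' i) * \<omega> i i + (\<Sum>k=Suc i..j. of_int (c' k) * \<omega> i k)"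
      using assms(3) by (subst sum.atLeast_Suc_atMost) auto
    also have "(\<Sum>k=Suc i..j. of_int (c' k) * \<omega> i k) = ?z"
      by (intro sum.cong) (auto simp: c'_def)
    finally have "(\<Sum>k=i..j. of_int (c' k) * \<omega> i k) = ?z - of_nat d"
      using assms(2) by (simp add: c'_def)
    moreover have "\<not> int p dvd c' j"
      using assms by (simp add: c'_def)
    ultimately show ?thesis
      using assms(1)[unfolded residually_independent_def, rule_format, of j c'] assms(3,4) by simp
  qed
  then show "wp p ?z \<noteq> 0" "vK (wp p ?z) = int p * vK (\<omega> i j)"
    unfolding K.wp_eq_prod by (auto simp: fls.v_prod)
qed

text \<open>As \<open>wp p\<close> is linear over the prime field, a combination at level
  \<open>Suc i\<close> is \<open>wp p\<close> of the same combination at level \<open>i\<close>,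
  divided by \<open>wp p (\<omega> i (Suc i))\<close>. Independence and valuations both pass through
  this quotient.\<close>

lemma omega_aux:
  "i \<le> n \<Longrightarrow> residually_independent i \<and> \<omega> i i = 1 \<and>
     (\<forall>j. i \<le> j \<longrightarrow> j \<le> n \<longrightarrow> vK (\<omega> i j) = int p ^ i * (vK (\<Omega> j) - vK (\<Omega> i)))"
proof (induction i)
  case 0
  then show ?case
    using Omega_combination Omega_0 by (auto simp: residually_independent_def Omega_iter.simps)
next
  case (Suc i)
  then have IH: "residually_independent i" "\<omega> i i = 1"
    "\<And>j. i \<le> j \<Longrightarrow> j \<le> n \<Longrightarrow> vK (\<omega> i j) = int p ^ i * (vK (\<Omega> j) - vK (\<Omega> i))"
    by auto
  note comb = wp_omega_combination[OF IH(1,2)]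
  have wp_omega: "wp p (\<omega> i j) \<noteq> 0" "vK (wp p (\<omega> i j)) = int p * vK (\<omega> i j)" if "i < j" "j \<le> n" for j
  proof -
    \<comment> \<open>Indicator coefficients specialize \<open>comb\<close> to a single
      element.\<close>
    have "(\<Sum>k=Suc i..j. of_int (if k = j then 1 else 0) * \<omega> i k) = \<omega> i j"
      using that by (subst sum.mono_neutral_right[of _ "{j}"]) auto
    then show "wp p (\<omega> i j) \<noteq> 0" "vK (wp p (\<omega> i j)) = int p * vK (\<omega> i j)"
      using comb[of j "\<lambda>k. if k = j then 1 else 0"] that K.p_gt_1 by simp_all
  qed
  let ?w = "wp p (\<omega> i (Suc i))"
  have w: "?w \<noteq> 0" "vK ?w = int p * vK (\<omega> i (Suc i))"
    using wp_omega[of "Suc i"] Suc.prems by auto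
  have v_Suc: "vK (\<omega> (Suc i) j) = int p * vK (\<omega> i j) - vK ?w" if "Suc i \<le> j" "j \<le> n" for j
    using wp_omega[of j] that w by (simp add: fls.v_divide Omega_iter.simps)
  have "residually_independent (Suc i)"
    unfolding residually_independent_def
  proof (intro allI impI)
    fix j and c :: "nat \<Rightarrow> int"
    assume j: "Suc i \<le> j" "j \<le> n" "\<not> int p dvd c j"
    have "(\<Sum>k=Suc i..j. of_int (c k) * \<omega> (Suc i) k) = wp p (\<Sum>k=Suc i..j. of_int (c k) * \<omega> i k) / ?w"
      by (simp add: K.wp_sum K.wp_of_int_mult sum_divide_distrib Omega_iter.simps)
    then show "(\<Sum>k=Suc i..j. of_int (c k) * \<omega> (Suc i) k) \<noteq> 0 \<and>
        vK (\<Sum>k=Suc i..j. of_int (c k) * \<omega> (Suc i) k) = vK (\<omega> (Suc i) j)"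
      using comb[of j c] j w v_Suc[of j] by (simp add: fls.v_divide)
  qed
  moreover have "\<omega> (Suc i) (Suc i) = 1"
    using w by (simp add: Omega_iter.simps)
  moreover have "vK (\<omega> (Suc i) j) = int p ^ Suc i * (vK (\<Omega> j) - vK (\<Omega> (Suc i)))"
    if "Suc i \<le> j" "j \<le> n" for j
    using v_Suc[OF that] w(2) IH(3)[of j] IH(3)[of "Suc i"] that Suc.prems
    by (simp add: algebra_simps)
  ultimately show ?case
    by (intro conjI allI impI)
qed

lemma omega_diag: "i \<le> n \<Longrightarrow> \<omega> i i = 1"
  using omega_aux[of i] by simp

lemma v_omega: "i \<le> j \<Longrightarrow> j \<le> n \<Longrightarrow> vK (\<omega> i j) = int p ^ i * (vK (\<Omega> j) - vK (\<Omega> i))"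
  using omega_aux[of i] by auto

lemma wp_omega_nonzero: "i < j \<Longrightarrow> j \<le> n \<Longrightarrow> wp p (\<omega> i j) \<noteq> 0"
  and v_wp_omega: "i < j \<Longrightarrow> j \<le> n \<Longrightarrow> vK (wp p (\<omega> i j)) = int p ^ Suc i * (vK (\<Omega> j) - vK (\<Omega> i))"
proof -
  assume j: "i < j" "j \<le> n"
  have "(\<Sum>k=Suc i..j. of_int (if k = j then 1 else 0) * \<omega> i k) = \<omega> i j"
    using j by (subst sum.mono_neutral_right[of _ "{j}"]) auto
  then show "wp p (\<omega> i j) \<noteq> 0" "vK (wp p (\<omega> i j)) = int p ^ Suc i * (vK (\<Omega> j) - vK (\<Omega> i))"
    using wp_omega_combination[of i j "\<lambda>k. if k = j then 1 else 0"] omega_aux[of i] j K.p_gt_1 v_omega[of i j]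
    by simp_all
qed

section \<open>The break numbers \<open>lower_break i\<close> and the bounds on the error
  terms\<close>

definition lower_break :: "nat \<Rightarrow> int" where
  "lower_break i = b + int p ^ n * (\<Sum>j=1..i. int p ^ j * m_gap \<Omega> j)"

lemma lower_break_0: "lower_break 0 = b"
  by (simp add: lower_break_def)

lemma lower_break_Suc:
  "lower_break (Suc i) = lower_break i + int p ^ (n + Suc i) * (vK (\<Omega> i) - vK (\<Omega> (Suc i)))"
  by (simp add: lower_break_def m_gap_def algebra_simps power_add)

lemma p_pos: "0 < int p ^ k"
  using K.p_gt_1 by simp

lemma lower_break_pos: "i \<le> n \<Longrightarrow> lower_break i > 0"
proof (induction i)
  case 0
  then show ?case
    using b_pos by (simp add: lower_break_0)
next
  case (Suc i)
  then have "0 \<le> int p ^ (n + Suc i) * (vK (\<Omega> i) - vK (\<Omega> (Suc i)))"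
    using Omega_decreasing[of i] by (intro mult_nonneg_nonneg) auto
  moreover have "0 < lower_break i"
    using Suc by simp
  ultimately show ?case
    unfolding lower_break_Suc by linarith
qed

text \<open>All increments are multiples of p^(n+1). Hence every break number may be replaced by
  \<open>b\<close> modulo the degree, which turns valuations of monomials into multiples of
  \<open>b\<close> by base-p expansions.\<close>

lemma lower_break_cong: "[lower_break i = b] (mod int p ^ (n + 1))"
proof (induction i)
  case (Suc i)
  have "int p ^ (n + 1) dvd int p ^ (n + Suc i) * (vK (\<Omega> i) - vK (\<Omega> (Suc i)))"
    by (intro dvd_mult2 le_imp_power_dvd) simp
  then show ?case
    using Suc unfolding lower_break_Suc cong_iff_dvd_diff
    by (metis add_diff_eq add.commute dvd_add_right_iff)
qed (simp add: lower_break_0)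

lemma lower_break_le:
  "i \<le> j \<Longrightarrow> j \<le> n \<Longrightarrow> lower_break j \<le> lower_break i + int p ^ n * (int p ^ n * (vK (\<Omega> i) - vK (\<Omega> j)))"
proof (induction j rule: dec_induct)
  case (step j)
  have "int p ^ (n + Suc j) * (vK (\<Omega> j) - vK (\<Omega> (Suc j))) \<le> int p ^ (n + n) * (vK (\<Omega> j) - vK (\<Omega> (Suc j)))"
    using step Omega_decreasing[of j] K.p_gt_1 by (intro mult_right_mono power_increasing) auto
  then show ?case
    using step by (simp add: lower_break_Suc power_add algebra_simps)
qed simp

text \<open>The right side of \<open>eps_bound\<close> equals - b_n / p^n + p^n (v(\<Omega>_j) -
  v(\<Omega>_n)) with b_n = \<open>lower_break n\<close>. Since \<open>div\<close> rounds down,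
  adding 1 gives the least integer beyond this strict bound.\<close>

definition eps_level :: "nat \<Rightarrow> int" where
  "eps_level j = (- lower_break n) div int p ^ n + 1 + int p ^ n * (vK (\<Omega> j) - vK (\<Omega> n))"

lemma sum_m_gap: "i \<le> j \<Longrightarrow> (\<Sum>k=i+1..j. m_gap \<Omega> k) = vK (\<Omega> i) - vK (\<Omega> j)"
  by (induction j rule: dec_induct) (simp_all add: m_gap_def)

lemma eps_vge:
  assumes "j \<le> n"
  shows "\<epsilon> j \<in> fls.vge (eps_level j)"
proof (cases "\<epsilon> j = 0")
  case False
  then have "1 \<le> j"
    using eps_0 by (cases j) auto
  define A where "A = (\<Sum>k=1..j. int p ^ k * m_gap \<Omega> k)"
  define B where "B = (\<Sum>k=j+1..n. int p ^ k * m_gap \<Omega> k)"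
  define M where "M = vK (\<Omega> j) - vK (\<Omega> n)"
  define P where "P = int p ^ n"
  have P: "P > 0"
    unfolding P_def by (rule p_pos)
  have "(\<Sum>k=1..n. int p ^ k * m_gap \<Omega> k) = A + B"
    using sum.ub_add_nat[of 1 j "\<lambda>k. int p ^ k * m_gap \<Omega> k" "n - j"] assms by (simp add: A_def B_def)
  then have AB: "lower_break n = b + P * (A + B)"
    by (simp add: lower_break_def P_def)
  have "(\<Sum>k=j+1..n. (P - int p ^ k) * m_gap \<Omega> k) = P * (\<Sum>k=j+1..n. m_gap \<Omega> k) - B"
    by (simp add: B_def algebra_simps sum_subtractf sum_distrib_left)
  also have "(\<Sum>k=j+1..n. m_gap \<Omega> k) = M"
    using sum_m_gap[OF assms] by (simp add: M_def)
  finally have "real_of_int (\<Sum>k=j+1..n. (P - int p ^ k) * m_gap \<Omega> k) = real_of_int (P * M - B)"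
    by (rule arg_cong)
  then have "(\<Sum>k=j+1..n. (real p ^ n - real p ^ k) * real_of_int (m_gap \<Omega> k)) = real_of_int (P * M - B)"
    by (simp add: P_def)
  moreover have "(\<Sum>k=1..j. real p ^ k * real_of_int (m_gap \<Omega> k)) = real_of_int A"
    by (simp add: A_def)
  moreover have "real p ^ n = real_of_int P"
    by (simp add: P_def)
  ultimately have "real_of_int (vK (\<epsilon> j)) > - (real_of_int b / real_of_int P) - real_of_int A + real_of_int (P * M - B)"
    using eps_bound[OF \<open>1 \<le> j\<close> assms False] by simp
  then have "real_of_int P * real_of_int (vK (\<epsilon> j)) > real_of_int P * (- (real_of_int b / real_of_int P) - real_of_int A + real_of_int (P * M - B))"
    using P by simp
  also have "real_of_int P * (- (real_of_int b / real_of_int P) - real_of_int A + real_of_int (P * M - B)) =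
      real_of_int (- lower_break n + P * (P * M))"
    using P by (simp add: AB field_simps)
  finally have "- lower_break n + P * (P * M) < P * vK (\<epsilon> j)"
    by (simp only: of_int_mult[symmetric] of_int_less_iff)
  then have less: "- lower_break n < P * (vK (\<epsilon> j) - P * M)"
    by (simp add: algebra_simps)
  have "(- lower_break n) div P < vK (\<epsilon> j) - P * M"
  proof (rule ccontr)
    assume "\<not> (- lower_break n) div P < vK (\<epsilon> j) - P * M"
    then have "P * (vK (\<epsilon> j) - P * M) \<le> P * ((- lower_break n) div P)"
      using P by simp
    also have "\<dots> \<le> - lower_break n"
      using pos_mod_sign[OF P, of "- lower_break n"] minus_mod_eq_mult_div[of "- lower_break n" P] by linarith
    finally show False
      using less by simp
  qed
  then show ?thesis
    by (simp add: fls.vge_def eps_level_def P_def M_def)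
qed simp

text \<open>
  \<open>X_iter i j\<close> is obtained from \<open>x j\<close> by clearing the contributions of \<open>X 0, \<dots>, X (i - 1)\<close>, so that
  \<open>(x 0, \<dots>, x n) = (X 0, \<dots>, X n) [\<Omega>\<^sup>\<phi>]\<close>.
\<close>

primrec X_iter :: "nat \<Rightarrow> nat \<Rightarrow> 'l" where
  "X_iter 0 = x"
| "X_iter (Suc i) = (\<lambda>j. X_iter i j - \<iota> (\<omega> i j ^ (p ^ (n - 1 - i))) * X_iter i i)"

primrec eps_iter :: "nat \<Rightarrow> nat \<Rightarrow> 'k fls" where
  "eps_iter 0 = \<epsilon>"
| "eps_iter (Suc i) = (\<lambda>j. eps_iter i j - \<omega> i j ^ (p ^ (n - i)) * eps_iter i i)"

abbreviation X :: "nat \<Rightarrow> 'l" where "X j \<equiv> X_iter j j"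

abbreviation E :: "nat \<Rightarrow> 'k fls" where "E j \<equiv> eps_iter j j"

text \<open>The main term of the Artin-Schreier equation of \<open>X i\<close>, see
  \<open>wp_X\<close>. It starts in K; from then on it is a multiple of the preceding generator by
  an element of K, so the equations form a chain.\<close>

primrec beta_iter :: "nat \<Rightarrow> 'l" where
  "beta_iter 0 = \<iota> \<beta>"
| "beta_iter (Suc i) = - (\<iota> (wp p (\<omega> i (Suc i)) ^ (p ^ (n - 1 - i))) * X i)"

text \<open>The multiplier \<open>\<omega> i j ^ (p ^ (n - i))\<close> has valuation
  \<open>eps_level j - eps_level i\<close>, so elimination preserves the bounds.\<close>

lemma eps_iter_vge: "i \<le> j \<Longrightarrow> j \<le> n \<Longrightarrow> eps_iter i j \<in> fls.vge (eps_level j)"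
proof (induction i arbitrary: j)
  case 0
  then show ?case
    by (simp add: eps_vge)
next
  case (Suc i)
  have "int (p ^ (n - i)) * vK (\<omega> i j) = int p ^ n * (vK (\<Omega> j) - vK (\<Omega> i))"
    using v_omega[of i j] Suc.prems by (simp add: power_add[symmetric])
  then have "\<omega> i j ^ (p ^ (n - i)) \<in> fls.vge (int p ^ n * (vK (\<Omega> j) - vK (\<Omega> i)))"
    using fls.vge_power[OF fls.vge_self[of "\<omega> i j"], of "p ^ (n - i)"] by simp
  then have "\<omega> i j ^ (p ^ (n - i)) * E i \<in> fls.vge (int p ^ n * (vK (\<Omega> j) - vK (\<Omega> i)) + eps_level i)"
    using Suc.IH[of i] Suc.prems by (intro fls.vge_mult) auto
  moreover have "int p ^ n * (vK (\<Omega> j) - vK (\<Omega> i)) + eps_level i = eps_level j"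
    by (simp add: eps_level_def algebra_simps)
  ultimately show ?case
    using Suc.IH[of j] Suc.prems by (simp add: fls.vge_diff)
qed

lemma wp_power_p_pow: "wp p (z ^ (p ^ k)) = (wp p (z :: 'k fls)) ^ (p ^ k)"
proof -
  have "(y - z) ^ (p ^ k) = y ^ (p ^ k) - z ^ (p ^ k)" for y z :: "'k fls"
    by (induction k arbitrary: y z) (simp_all add: power_mult K.diff_power_p)
  then show ?thesis
    by (simp add: wp_def power_mult[symmetric] mult.commute)
qed

text \<open>Subtracting \<open>\<iota> u * X i\<close>, where \<open>u ^ p\<close> is the
  coefficient of \<open>beta_iter i\<close>, cancels that main term. What remains is
  \<open>- \<iota> (wp p u) * X i\<close> and an error from K; \<open>wp p\<close> commutes with
  powers of Frobenius, which produces \<open>\<omega> (Suc i) j\<close> and the new main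
  term.\<close>

lemma wp_X_iter:
  "i \<le> j \<Longrightarrow> j \<le> n \<Longrightarrow> wp p (X_iter i j) = \<iota> (\<omega> i j ^ (p ^ (n - i))) * beta_iter i + \<iota> (eps_iter i j)"
proof (induction i arbitrary: j)
  case 0
  then show ?case
    using artin_schreier[of j] by (simp add: wp_def frob_funpow hom_distribs Omega_iter.simps)
next
  case (Suc i)
  define u where "u = \<omega> i j ^ (p ^ (n - 1 - i))"
  define w where "w = wp p (\<omega> i (Suc i))"
  have ni: "n - i = Suc (n - Suc i)" and n1: "n - 1 - i = n - Suc i"
    using Suc.prems by auto
  have up: "u ^ p = \<omega> i j ^ (p ^ (n - i))"
    by (simp add: u_def ni n1 power_mult[symmetric] mult.commute)
  have Xp: "X i ^ p = X i + (beta_iter i + \<iota> (E i))"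
    using Suc.IH[of i] Suc.prems by (simp add: wp_def omega_diag algebra_simps)
  have wpu: "wp p u = \<omega> (Suc i) j ^ (p ^ (n - Suc i)) * w ^ (p ^ (n - Suc i))"
    using wp_omega_nonzero[of i "Suc i"] Suc.prems
    by (simp add: u_def n1 wp_power_p_pow Omega_iter.simps w_def power_mult_distrib[symmetric])
  have "wp p (X_iter (Suc i) j) = wp p (X_iter i j) - (\<iota> u ^ p * X i ^ p - \<iota> u * X i)"
    unfolding u_def by (simp add: L.wp_diff) (simp add: wp_def power_mult_distrib)
  also have "\<dots> = \<iota> (u ^ p) * beta_iter i + \<iota> (eps_iter i j) - (\<iota> u ^ p * X i ^ p - \<iota> u * X i)"
    using Suc.IH[of j] Suc.prems by (simp add: up)
  also have "\<dots> = \<iota> (eps_iter i j) - \<iota> (u ^ p * E i) - \<iota> (wp p u) * X i"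
    unfolding Xp by (simp add: wp_def hom_distribs algebra_simps)
  also have "\<dots> = \<iota> (\<omega> (Suc i) j ^ (p ^ (n - Suc i))) * beta_iter (Suc i) + \<iota> (eps_iter (Suc i) j)"
    unfolding wpu up by (simp add: w_def n1 hom_distribs)
  finally show ?case .
qed

section \<open>Valuations of the generators \<open>X i\<close>\<close>

lemma wp_X: "i \<le> n \<Longrightarrow> wp p (X i) = beta_iter i + \<iota> (E i)"
  using wp_X_iter[of i i] by (simp add: omega_diag)

text \<open>With \<open>lower_break_le\<close>, the level bound becomes p^n v(E_i) > - b_i.
  Replacing p^n by p^i increases the left side when the valuation is negative; otherwise the claim
  follows from b_i > 0. In this form it makes \<open>beta_iter i\<close> dominate
  \<open>\<iota> (E i)\<close>.\<close>

lemma E_vge: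
  assumes "i \<le> n" "E i \<noteq> 0"
  shows "int p ^ i * vK (E i) > - lower_break i"
proof -
  define P where "P = int p ^ n"
  define M where "M = vK (\<Omega> i) - vK (\<Omega> n)"
  have P: "P > 0"
    unfolding P_def by (rule p_pos)
  have "eps_level i \<le> vK (E i)"
    using eps_iter_vge[of i i] assms by (auto simp: fls.vge_def)
  then have "P * eps_level i \<le> P * vK (E i)"
    using P by simp
  moreover have "P * eps_level i = P * ((- lower_break n) div P) + P + P * (P * M)"
    by (simp add: eps_level_def P_def M_def algebra_simps)
  \<comment> \<open>Rounding down loses less than one multiple of \<open>P\<close>.\<close>
  moreover have "P * ((- lower_break n) div P) + P > - lower_break n"
    using pos_mod_bound[OF P, of "- lower_break n"] minus_mod_eq_mult_div[of "- lower_break n" P] by linarith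
  moreover have "lower_break n \<le> lower_break i + P * (P * M)"
    using lower_break_le[of i n] assms by (simp add: P_def M_def)
  ultimately have bound: "P * vK (E i) > - lower_break i"
    by linarith
  show ?thesis
  proof (cases "vK (E i) \<ge> 0")
    case True
    then have "0 \<le> int p ^ i * vK (E i)"
      by simp
    then show ?thesis
      using lower_break_pos[OF assms(1)] by linarith
  next
    case False
    have "int p ^ i \<le> P"
      unfolding P_def using assms K.p_gt_1 by (intro power_increasing) auto
    then have "P * vK (E i) \<le> int p ^ i * vK (E i)"
      using False by (intro mult_right_mono_neg) auto
    then show ?thesis
      using bound by linarith
  qed
qed

text \<open>The main term dominates the error, so \<open>wp p (X i)\<close> has a pole of known
  order, which is p times the pole order of \<open>X i\<close>.\<close>

lemma X_from_beta_iter: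
  assumes "i \<le> n" "beta_iter i \<noteq> 0" "vL (beta_iter i) = - (int p ^ Suc (n - i) * lower_break i)"
  shows "X i \<noteq> 0" "vL (X i) = - (int p ^ (n - i) * lower_break i)"
proof -
  have "vL (beta_iter i) < vL (\<iota> (E i))" if "E i \<noteq> 0"
  proof -
    have "int p ^ Suc (n - i) * (- lower_break i) < int p ^ Suc (n - i) * (int p ^ i * vK (E i))"
      by (rule mult_strict_left_mono[OF E_vge[OF assms(1) that] p_pos])
    moreover have "int p ^ Suc (n - i) * (int p ^ i * vK (E i)) = int p ^ (n + 1) * vK (E i)"
      using assms(1) by (simp add: mult.assoc[symmetric] power_add[symmetric] del: power_Suc)
    ultimately show ?thesis
      unfolding vL_\<iota>[OF that] assms(3) by (simp only: mult_minus_right)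
  qed
  then have "\<iota> (E i) \<in> vL.vge (vL (beta_iter i) + 1)"
    by (cases "E i = 0") (auto simp: vL.vge_def)
  then have wpX: "wp p (X i) \<noteq> 0" "vL (wp p (X i)) = - (int p ^ Suc (n - i) * lower_break i)"
    using vL.v_add_dominant[of "beta_iter i" "\<iota> (E i)" "vL (beta_iter i) + 1"] assms wp_X[of i] by simp_all
  moreover have "0 < int p ^ Suc (n - i) * lower_break i"
    using lower_break_pos[OF assms(1)] p_pos by (intro mult_pos_pos)
  ultimately have "X i \<noteq> 0 \<and> int p * vL (X i) = int p * - (int p ^ (n - i) * lower_break i)"
    using vL.v_from_wp_neg[of p "X i"] K.p_gt_1 by simp
  then show "X i \<noteq> 0" "vL (X i) = - (int p ^ (n - i) * lower_break i)"
    unfolding mult_cancel_left using K.p_gt_1 by simp_all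
qed

lemma v_beta_iter_Suc:
  assumes "i < n" "X i \<noteq> 0"
  shows "beta_iter (Suc i) \<noteq> 0"
    "vL (beta_iter (Suc i)) = vL (X i) + int p ^ (n - i) * int p ^ (n + Suc i) * (vK (\<Omega> (Suc i)) - vK (\<Omega> i))"
proof -
  let ?w = "wp p (\<omega> i (Suc i))"
  have w: "?w \<noteq> 0" "vK ?w = int p ^ Suc i * (vK (\<Omega> (Suc i)) - vK (\<Omega> i))"
    using wp_omega_nonzero[of i "Suc i"] v_wp_omega[of i "Suc i"] assms by auto
  have "vL (\<iota> (?w ^ (p ^ (n - 1 - i)))) = int p ^ (n - i) * int p ^ (n + Suc i) * (vK (\<Omega> (Suc i)) - vK (\<Omega> i))"
  proof -
    have "n - i = Suc (n - 1 - i)"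
      using assms by simp
    then show ?thesis
      using w by (simp add: vL_\<iota> fls_subdegree_pow power_add)
  qed
  then show "beta_iter (Suc i) \<noteq> 0"
    "vL (beta_iter (Suc i)) = vL (X i) + int p ^ (n - i) * int p ^ (n + Suc i) * (vK (\<Omega> (Suc i)) - vK (\<Omega> i))"
    using w assms by (simp_all add: vL.v_uminus vL.v_mult)
qed

text \<open>At each step the coefficient in \<open>beta_iter (Suc i)\<close> turns
  \<open>lower_break i\<close> into \<open>lower_break (Suc i)\<close>, and solving the
  Artin-Schreier equation divides the valuation by p.\<close>

lemma X_aux: "i \<le> n \<Longrightarrow> X i \<noteq> 0 \<and> vL (X i) = - (int p ^ (n - i) * lower_break i)"
proof (induction i)
  case 0
  have "beta_iter 0 \<noteq> 0" "vL (beta_iter 0) = - (int p ^ Suc (n - 0) * lower_break 0)"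
    using beta_nonzero beta_valuation by (simp_all add: vL_\<iota> lower_break_0)
  then show ?case
    using X_from_beta_iter[of 0] by simp
next
  case (Suc i)
  then have i: "i < n" "X i \<noteq> 0" "vL (X i) = - (int p ^ (n - i) * lower_break i)"
    by auto
  have "beta_iter (Suc i) \<noteq> 0" "vL (beta_iter (Suc i)) = - (int p ^ Suc (n - Suc i) * lower_break (Suc i))"
    using v_beta_iter_Suc[OF i(1,2)] i Suc_diff_Suc[OF i(1)]
    by (simp_all add: lower_break_Suc algebra_simps del: beta_iter.simps power_Suc)
  then show ?case
    using X_from_beta_iter[of "Suc i"] Suc.prems by simp
qed

lemma X_nonzero: "i \<le> n \<Longrightarrow> X i \<noteq> 0"
  and v_X: "i \<le> n \<Longrightarrow> vL (X i) = - (int p ^ (n - i) * lower_break i)"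
  using X_aux by auto

end

section \<open>Bases with distinct valuations\<close>

lemma sum_digits: "(\<Sum>s<k. (N div q ^ s mod q) * q ^ s) = N mod (q ^ k :: nat)"
  by (induction k) (simp_all add: power_Suc2 mod_mult2_eq mult.commute[of _ "q ^ _"] del: power_Suc)

context near_one_dim
begin

definition deg :: nat where "deg = p ^ (n + 1)"

lemma deg_pos: "0 < deg"
  using K.p_gt_1 by (simp add: deg_def)

lemma vL_\<iota>_deg: "c \<noteq> 0 \<Longrightarrow> vL (\<iota> c) = int deg * vK c"
  by (simp add: vL_\<iota> deg_def)

context
  fixes f :: "nat \<Rightarrow> 'l"
  assumes f_nonzero: "\<And>N. N < deg \<Longrightarrow> f N \<noteq> 0"
    and f_distinct: "\<And>N M. N < deg \<Longrightarrow> M < deg \<Longrightarrow> [vL (f N) = vL (f M)] (mod int deg) \<Longrightarrow> N = M"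
begin

lemma v_term_cong:
  assumes "N < deg" "c \<noteq> 0"
  shows "[vL (\<iota> c * f N) = vL (f N)] (mod int deg)"
  using assms f_nonzero[of N] by (simp add: vL.v_mult vL_\<iota>_deg cong_iff_dvd_diff)

text \<open>Coefficients from K change valuations by multiples of [L : K], so incongruent valuations
  remain distinct whatever the coefficients are.\<close>

lemma inj_v_term: "inj_on (\<lambda>N. vL (\<iota> (c N) * f N)) {N \<in> {..<deg}. \<iota> (c N) * f N \<noteq> 0}"
proof (rule inj_onI)
  fix N M
  assume N: "N \<in> {N \<in> {..<deg}. \<iota> (c N) * f N \<noteq> 0}" and M: "M \<in> {N \<in> {..<deg}. \<iota> (c N) * f N \<noteq> 0}"
    and eq: "vL (\<iota> (c N) * f N) = vL (\<iota> (c M) * f M)"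
  have "[vL (f N) = vL (\<iota> (c N) * f N)] (mod int deg)"
    using v_term_cong[of N "c N"] N cong_sym by auto
  also have "[vL (\<iota> (c N) * f N) = vL (f M)] (mod int deg)"
    unfolding eq using v_term_cong[of M "c M"] M by auto
  finally show "N = M"
    using f_distinct[of N M] N M by simp
qed

text \<open>A relation with a nonzero coefficient would have terms of distinct valuations and so
  could not vanish. Thus \<open>deg\<close> independent elements lie in a space of dimension
  \<open>deg\<close> and span it.\<close>

lemma expansion_exists: "\<exists>c. z = (\<Sum>N<deg. \<iota> (c N) * f N)"
proof -
  interpret V: vector_space "\<lambda>c z. \<iota> c * z"
    by unfold_locales (simp_all add: hom_distribs algebra_simps)
  have inj: "inj_on f {..<deg}"
  proof (rule inj_onI)
    fix N M assume "N \<in> {..<deg}" "M \<in> {..<deg}" "f N = f M"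
    then show "N = M"
      using f_distinct[of N M] by simp
  qed
  let ?A = "f ` {..<deg}"
  have indep: "V.independent ?A"
  proof (rule V.independent_if_scalars_zero)
    fix g y assume g: "(\<Sum>y\<in>?A. \<iota> (g y) * y) = 0" and y: "y \<in> ?A"
    then obtain M where M: "M < deg" "y = f M"
      by auto
    have sum0: "(\<Sum>N<deg. \<iota> (g (f N)) * f N) = 0"
      using g by (simp add: sum.reindex[OF inj])
    show "g y = 0"
    proof (rule ccontr)
      assume "g y \<noteq> 0"
      then have nz: "\<iota> (g (f M)) * f M \<noteq> 0"
        using M f_nonzero[of M] by simp
      show False
        by (rule vL.sum_distinct_valuations[OF finite_lessThan _ nz inj_v_term[of "\<lambda>N. g (f N)"]])
          (use M sum0 in simp_all)
    qed
  qed simp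
  have dim: "V.dim (UNIV :: 'l set) = deg"
    using degree by (simp add: ext_degree_def deg_def)
  obtain B where B: "V.independent B" "UNIV \<subseteq> V.span B" "card B = deg"
    using V.basis_exists[of UNIV] dim by metis
  \<comment> \<open>A positive cardinality excludes the value 0 that \<open>card\<close> takes on
    infinite sets.\<close>
  have finB: "finite B"
    using B(3) deg_pos card_ge_0_finite[of B] by simp
  have "z \<in> V.span ?A"
  proof (rule ccontr)
    assume z: "z \<notin> V.span ?A"
    then have "V.independent (insert z ?A)"
      using indep by (rule V.independent_insertI)
    then have "card (insert z ?A) \<le> card B"
      using V.independent_span_bound[OF finB] B(2) by auto
    moreover have "z \<notin> ?A"
      using z V.span_base by auto
    ultimately show False
      using B(3) by (simp add: card_image[OF inj])
  qed
  then obtain u where "z = (\<Sum>y\<in>?A. \<iota> (u y) * y)"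
    using V.span_finite[of ?A] by auto
  then have "z = (\<Sum>N<deg. \<iota> (u (f N)) * f N)"
    by (simp add: sum.reindex[OF inj])
  then show ?thesis
    by (intro exI[of _ "\<lambda>N. u (f N)"])
qed

lemma expansion:
  assumes "z \<noteq> 0"
  obtains c m where "z = (\<Sum>N<deg. \<iota> (c N) * f N)" "m < deg" "c m \<noteq> 0" "vL (\<iota> (c m) * f m) = vL z"
    "\<And>N. N < deg \<Longrightarrow> N \<noteq> m \<Longrightarrow> c N \<noteq> 0 \<Longrightarrow> vL z < vL (\<iota> (c N) * f N)"
    "[vL z = vL (f m)] (mod int deg)"
proof -
  obtain c where z: "z = (\<Sum>N<deg. \<iota> (c N) * f N)"
    using expansion_exists by blast
  obtain i where i: "i \<in> {..<deg}" "\<iota> (c i) * f i \<noteq> 0"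
    using assms z sum.neutral[of "{..<deg}" "\<lambda>N. \<iota> (c N) * f N"] by metis
  obtain m where m: "m \<in> {..<deg}" "\<iota> (c m) * f m \<noteq> 0" "vL z = vL (\<iota> (c m) * f m)"
    "\<And>j. j \<in> {..<deg} \<Longrightarrow> j \<noteq> m \<Longrightarrow> \<iota> (c j) * f j \<noteq> 0 \<Longrightarrow> vL (\<iota> (c m) * f m) < vL (\<iota> (c j) * f j)"
    using vL.sum_distinct_valuations[OF finite_lessThan i inj_v_term[of c]] unfolding z by blast
  show ?thesis
  proof (rule that[OF z])
    show "m < deg" "c m \<noteq> 0" "vL (\<iota> (c m) * f m) = vL z"
      using m by auto
    then show "[vL z = vL (f m)] (mod int deg)"
      using v_term_cong[of m "c m"] by simp
    show "vL z < vL (\<iota> (c N) * f N)" if "N < deg" "N \<noteq> m" "c N \<noteq> 0" for N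
      using m(3,4) that f_nonzero[of N] by simp
  qed
qed

end

text \<open>Numbers below p^(n+1) encode exponent vectors: digit \<open>s\<close> is the exponent of
  \<open>X (n - s)\<close>, whose valuation carries the factor p^s.\<close>

definition digit :: "nat \<Rightarrow> nat \<Rightarrow> nat" where
  "digit N s = N div p ^ s mod p"

lemma digit_less: "digit N s < p"
  using K.p_gt_1 by (simp add: digit_def)

lemma sum_digit: "N < deg \<Longrightarrow> (\<Sum>s\<le>n. digit N s * p ^ s) = N"
  using sum_digits[where k = "Suc n" and q = p and N = N] by (simp add: digit_def deg_def lessThan_Suc_atMost)

lemma v_X_neg: "i \<le> n \<Longrightarrow> vL (X i) < 0"
  using mult_pos_pos[OF p_pos lower_break_pos, of i "n - i"] by (simp only: v_X neg_less_0_iff_less)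

lemma v_X_rev: "s \<le> n \<Longrightarrow> vL (X (n - s)) = - (int p ^ s * lower_break (n - s))"
  using v_X[of "n - s"] by simp

context
  fixes g :: "nat \<Rightarrow> nat \<Rightarrow> 'l"
  assumes g: "\<And>s e. s \<le> n \<Longrightarrow> e < p \<Longrightarrow> g s e \<noteq> 0 \<and> vL (g s e) = int e * vL (X (n - s))"
begin

text \<open>\<open>g s e\<close> stands both for \<open>X (n - s) ^ e\<close> and for
  \<open>binom (X (n - s)) e\<close>; their common valuation is all that enters.\<close>

lemma v_prod_g:
  assumes "\<And>s. s \<le> n \<Longrightarrow> e s < p"
  shows "(\<Prod>s\<le>n. g s (e s)) \<noteq> 0"
    and "vL (\<Prod>s\<le>n. g s (e s)) = - (\<Sum>s\<le>n. int (e s) * int p ^ s * lower_break (n - s))"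
proof -
  show "(\<Prod>s\<le>n. g s (e s)) \<noteq> 0"
    using g assms by auto
  have "vL (\<Prod>s\<le>n. g s (e s)) = (\<Sum>s\<le>n. vL (g s (e s)))"
    using g assms by (intro vL.v_prod) auto
  also have "\<dots> = (\<Sum>s\<le>n. - (int (e s) * int p ^ s * lower_break (n - s)))"
    using g assms by (intro sum.cong) (auto simp: v_X_rev)
  finally show "vL (\<Prod>s\<le>n. g s (e s)) = - (\<Sum>s\<le>n. int (e s) * int p ^ s * lower_break (n - s))"
    by (simp add: sum_negf)
qed

lemma v_digit_prod_cong:
  assumes "N < deg"
  shows "[vL (\<Prod>s\<le>n. g s (digit N s)) = - (int N * b)] (mod int deg)"
proof -
  have "[(\<Sum>s\<le>n. int (digit N s) * int p ^ s * lower_break (n - s)) = (\<Sum>s\<le>n. int (digit N s) * int p ^ s * b)] (mod int deg)"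
    using lower_break_cong by (intro cong_sum cong_mult cong_refl) (simp add: deg_def)
  moreover have "(\<Sum>s\<le>n. int (digit N s) * int p ^ s * b) = int (\<Sum>s\<le>n. digit N s * p ^ s) * b"
    by (simp add: sum_distrib_right)
  ultimately have "[(\<Sum>s\<le>n. int (digit N s) * int p ^ s * lower_break (n - s)) = int N * b] (mod int deg)"
    by (simp only: sum_digit[OF assms])
  then show ?thesis
    using v_prod_g[of "digit N"] digit_less by (simp add: cong_minus_minus_iff)
qed

text \<open>Modulo p^(n+1) the valuation is - N b, and \<open>b\<close> is invertible there.\<close>

lemma digit_prod_distinct:
  assumes "N < deg" "M < deg" "[vL (\<Prod>s\<le>n. g s (digit N s)) = vL (\<Prod>s\<le>n. g s (digit M s))] (mod int deg)"
  shows "N = M"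
proof -
  have "[- (int N * b) = vL (\<Prod>s\<le>n. g s (digit N s))] (mod int deg)"
    using v_digit_prod_cong[OF assms(1)] by (rule cong_sym)
  also note assms(3)
  also note v_digit_prod_cong[OF assms(2)]
  finally have "[int N * b = int M * b] (mod int deg)"
    by (simp only: cong_minus_minus_iff)
  moreover have "coprime b (int deg)"
    using b_coprime by (simp add: deg_def)
  ultimately have "[int N = int M] (mod int deg)"
    using cong_mult_rcancel by blast
  then have "int N mod int deg = int M mod int deg"
    by (simp only: cong_def)
  then show ?thesis
    using assms(1,2) by (simp only: mod_pos_pos_trivial of_nat_0_le_iff of_nat_less_iff of_nat_eq_iff)
qed

lemma digit_prod_nonzero: "(\<Prod>s\<le>n. g s (digit N s)) \<noteq> 0"
  using v_prod_g[of "digit N"] digit_less by simp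

end

end

section \<open>The largest lower ramification break\<close>

lemma app_hom: "field_hom (app \<tau>)"
  using app[of \<tau>] by simp

context near_one_dim
begin

lemma galois_fixes: "\<tau> \<in> galois_group \<iota> \<Longrightarrow> app \<tau> (\<iota> c) = \<iota> c"
  by (simp add: galois_group_def)

text \<open>The coefficient in
  \<open>wp p (X (Suc i)) = - (step i * X i) + \<iota> (E (Suc i))\<close>. It comes from K and is
  therefore fixed by the Galois group.\<close>

definition step :: "nat \<Rightarrow> 'l" where
  "step i = \<iota> (wp p (\<omega> i (Suc i)) ^ (p ^ (n - 1 - i)))"

lemma beta_iter_step: "beta_iter (Suc i) = - (step i * X i)"
  by (simp add: step_def)

lemma step_nonzero: "i < n \<Longrightarrow> step i \<noteq> 0"
  using wp_omega_nonzero[of i "Suc i"] by (simp add: step_def)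

lemma v_step:
  assumes "i < n"
  shows "vL (step i) = int p * vL (X (Suc i)) - vL (X i)" "vL (step i) \<le> 0"
proof -
  have eq: "vL (beta_iter (Suc i)) = vL (step i) + vL (X i)"
    unfolding beta_iter_step using step_nonzero[OF assms] X_nonzero[of i] assms
    by (simp add: vL.v_uminus vL.v_mult)
  then have st: "vL (step i) = int p ^ (n - i) * int p ^ (n + Suc i) * (vK (\<Omega> (Suc i)) - vK (\<Omega> i))"
    using v_beta_iter_Suc(2)[OF assms X_nonzero[of i]] assms by simp
  then show "vL (step i) \<le> 0"
    using Omega_decreasing[OF assms] by (simp add: mult_nonneg_nonpos)
  have "int p * vL (X (Suc i)) = - (int p ^ Suc (n - Suc i) * lower_break (Suc i))"
    using v_X[of "Suc i"] assms by simp
  also have "Suc (n - Suc i) = n - i"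
    using assms by simp
  finally show "vL (step i) = int p * vL (X (Suc i)) - vL (X i)"
    using v_X[of i] assms by (simp only: st lower_break_Suc) (simp add: algebra_simps)
qed

section \<open>How far a fixed Galois automorphism moves the \<open>X i\<close>\<close>

context
  fixes \<tau> :: "'l field_auto"
  assumes \<tau>: "\<tau> \<in> galois_group \<iota>"
begin

definition shift :: "nat \<Rightarrow> 'l" where
  "shift i = app \<tau> (X i) - X i"

interpretation \<tau>: field_hom "app \<tau>"
  by (rule app_hom)

lemma wp_shift: "i \<le> n \<Longrightarrow> wp p (shift i) = app \<tau> (beta_iter i) - beta_iter i"
proof -
  assume i: "i \<le> n"
  have "wp p (shift i) = app \<tau> (wp p (X i)) - wp p (X i)"
    by (simp add: shift_def L.wp_diff) (simp add: wp_def \<tau>.hom_minus \<tau>.hom_power)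
  then show ?thesis
    using wp_X[OF i] galois_fixes[OF \<tau>] by (simp add: \<tau>.hom_add)
qed

lemma wp_shift_0: "wp p (shift 0) = 0"
  using wp_shift[of 0] galois_fixes[OF \<tau>] by simp

text \<open>The errors \<open>E\<close> come from K and cancel, so the increments satisfy the chain
  of equations exactly.\<close>

lemma wp_shift_Suc: "i < n \<Longrightarrow> wp p (shift (Suc i)) = - (step i * shift i)"
  using wp_shift[of "Suc i"] galois_fixes[OF \<tau>]
  by (simp add: shift_def \<tau>.hom_uminus \<tau>.hom_mult step_def right_diff_distrib)

lemma v_wp_zero: "wp p z = 0 \<Longrightarrow> z \<noteq> 0 \<Longrightarrow> vL z = 0"
  using vL.v_fixed_power[of z p] K.p_gt_1 by (simp add: wp_def)

lemma v_wp_shift_Suc: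
  assumes "i < n" "shift i \<noteq> 0"
  shows "wp p (shift (Suc i)) \<noteq> 0" "vL (wp p (shift (Suc i))) = vL (step i) + vL (shift i)"
  using assms wp_shift_Suc[of i] step_nonzero[of i] by (simp_all add: vL.v_uminus vL.v_mult)

text \<open>The first nonzero increment is fixed by the p-th power map and has valuation 0.
  Multiplication by \<open>step i\<close> does not raise valuations, and a value of
  \<open>wp p\<close> with valuation at most 0 forces the same for its argument.\<close>

lemma v_shift_nonpos: "i \<le> n \<Longrightarrow> shift i \<noteq> 0 \<Longrightarrow> vL (shift i) \<le> 0"
proof (induction i)
  case 0
  then show ?case
    using v_wp_zero[OF wp_shift_0] by simp
next
  case (Suc i)
  show ?case
  proof (cases "shift i = 0")
    case True
    then show ?thesis
      using v_wp_zero[of "shift (Suc i)"] wp_shift_Suc[of i] Suc.prems by simp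
  next
    case False
    then show ?thesis
      using vL.v_from_wp_nonpos(2)[of p "shift (Suc i)"] v_wp_shift_Suc[of i] v_step(2)[of i]
        Suc.IH Suc.prems K.p_gt_1 by simp
  qed
qed

lemma shift_Suc_nonzero:
  assumes "i < n" "shift i \<noteq> 0"
  shows "shift (Suc i) \<noteq> 0"
  using vL.v_from_wp_nonpos(1)[of p "shift (Suc i)"] v_wp_shift_Suc[OF assms] v_step(2)[of i]
    v_shift_nonpos[of i] assms K.p_gt_1 by simp

lemma shift_nonzero_mono: "i \<le> j \<Longrightarrow> j \<le> n \<Longrightarrow> shift i \<noteq> 0 \<Longrightarrow> shift j \<noteq> 0"
proof (induction j rule: dec_induct)
  case (step j)
  then show ?case
    using shift_Suc_nonzero[of j] by simp
qed

text \<open>The valuation of (\<tau> - 1) X_i / X_i, meaningful when \<open>shift i\<close> is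
  nonzero.\<close>

definition gain :: "nat \<Rightarrow> int" where
  "gain i = vL (shift i) - vL (X i)"

lemma v_shift_cases:
  assumes "z \<noteq> 0" "vL z \<le> 0"
  shows "vL z = 0 \<or> (vL z < 0 \<and> vL (wp p z) = int p * vL z)"
  using assms vL.v_wp_neg(2)[of z p] K.p_gt_1 by auto

lemma gain_pos: "i \<le> n \<Longrightarrow> shift i \<noteq> 0 \<Longrightarrow> gain i > 0"
proof (induction i)
  case 0
  then show ?case
    using v_wp_zero[OF wp_shift_0] v_X_neg[of 0] by (simp add: gain_def)
next
  case (Suc i)
  show ?case
  proof (cases "vL (shift (Suc i)) = 0")
    case True
    then show ?thesis
      using v_X_neg[of "Suc i"] Suc.prems by (simp add: gain_def)
  next
    case False
    then have wp: "vL (wp p (shift (Suc i))) = int p * vL (shift (Suc i))"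
      using v_shift_cases[OF Suc.prems(2) v_shift_nonpos] Suc.prems by simp
    have "shift i \<noteq> 0"
      using False v_wp_zero[of "shift (Suc i)"] wp_shift_Suc[of i] Suc.prems by auto
    then have "int p * gain (Suc i) = gain i" "gain i > 0"
      using wp v_wp_shift_Suc(2)[of i] v_step(1)[of i] Suc by (simp_all add: gain_def algebra_simps)
    then show ?thesis
      using K.p_gt_1 zero_less_mult_pos[of "int p" "gain (Suc i)"] by simp
  qed
qed

text \<open>If \<open>shift (Suc i)\<close> has a pole, then
  \<open>gain i = p * gain (Suc i)\<close>; if it is a unit, p v(X) < v(X) for the negative v(X) of
  \<open>X (Suc i)\<close> suffices. Strict decrease means that \<tau> moves \<open>X n\<close> by
  the largest relative amount.\<close>

lemma gain_Suc_less:
  assumes "i < n" "shift i \<noteq> 0"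
  shows "gain (Suc i) < gain i"
proof -
  note nz = shift_Suc_nonzero[OF assms]
  have gi: "gain i = vL (wp p (shift (Suc i))) - int p * vL (X (Suc i))"
    using v_wp_shift_Suc(2)[OF assms] v_step(1)[of i] assms by (simp add: gain_def)
  have g: "gain (Suc i) > 0"
    using gain_pos[of "Suc i"] nz assms by simp
  show ?thesis
  proof (cases "vL (shift (Suc i)) = 0")
    case True
    then have "wp p (shift (Suc i)) \<in> vL.vge 0"
      by (intro vL.wp_vge_0) (simp add: vL.vge_def)
    then have "0 \<le> vL (wp p (shift (Suc i)))"
      using v_wp_shift_Suc(1)[OF assms] by (simp add: vL.vge_def)
    moreover have "int p * vL (X (Suc i)) < 1 * vL (X (Suc i))"
      using v_X_neg[of "Suc i"] assms K.p_gt_1 by (intro mult_strict_right_mono_neg) auto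
    ultimately show ?thesis
      using True gi by (simp add: gain_def)
  next
    case False
    then have "vL (wp p (shift (Suc i))) = int p * vL (shift (Suc i))"
      using v_shift_cases[OF nz v_shift_nonpos[OF _ nz]] assms by simp
    then have "gain i = int p * gain (Suc i)"
      using gi by (simp add: gain_def algebra_simps)
    moreover have "1 * gain (Suc i) < int p * gain (Suc i)"
      using g K.p_gt_1 by (intro mult_strict_right_mono) auto
    ultimately show ?thesis
      by simp
  qed
qed

lemma gain_less:
  assumes "i < n" "shift i \<noteq> 0"
  shows "gain n < gain i"
proof -
  have "gain k < gain i" if "Suc i \<le> k" "k \<le> n" for k
    using that
  proof (induction k rule: dec_induct)
    case base
    then show ?case
      using gain_Suc_less assms by simp
  next
    case (step k)
    then show ?case
      using gain_Suc_less[of k] shift_nonzero_mono[of i k] assms by simp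
  qed
  then show ?thesis
    using assms(1) by simp
qed

section \<open>The action of an automorphism on monomials in the \<open>X i\<close>\<close>

definition monomial :: "nat \<Rightarrow> 'l" where
  "monomial N = (\<Prod>s\<le>n. X (n - s) ^ digit N s)"

lemma monomial_factor: "s \<le> n \<Longrightarrow> e < p \<Longrightarrow> X (n - s) ^ e \<noteq> 0 \<and> vL (X (n - s) ^ e) = int e * vL (X (n - s))"
  using X_nonzero[of "n - s"] by (simp add: vL.v_power)

lemma monomial_nonzero: "monomial N \<noteq> 0"
  unfolding monomial_def by (rule digit_prod_nonzero[OF monomial_factor])

lemma monomial_distinct:
  "N < deg \<Longrightarrow> M < deg \<Longrightarrow> [vL (monomial N) = vL (monomial M)] (mod int deg) \<Longrightarrow> N = M"
  unfolding monomial_def by (rule digit_prod_distinct[OF monomial_factor])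

lemma v_monomial_cong: "N < deg \<Longrightarrow> [vL (monomial N) = - (int N * b)] (mod int deg)"
  unfolding monomial_def by (rule v_digit_prod_cong[OF monomial_factor])

text \<open>Relative to the monomial, \<tau> acts as the product of the
  \<open>(1 + y s) ^ digit N s\<close>. For s > 0 these factors are 1 up to valuation
  \<open>gain n + 1\<close>, by \<open>gain_less\<close>; the factor of \<open>X n\<close>, at s =
  0, gives the first-order term.\<close>

lemma galois_monomial:
  assumes "shift n \<noteq> 0"
  shows "app \<tau> (monomial N) - monomial N - of_nat (digit N 0) * (shift n / X n) * monomial N
    \<in> vL.vge (vL (monomial N) + gain n + 1)"
proof -
  define y where "y s = shift (n - s) / X (n - s)" for s
  define u where "u = (\<Prod>s\<in>{1..n}. (1 + y s) ^ digit N s)"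
  have g: "gain n \<ge> 1"
    using gain_pos[of n] assms by simp
  have y: "y s \<in> vL.vge (gain n + 1)" if "1 \<le> s" "s \<le> n" for s
  proof (cases "shift (n - s) = 0")
    case False
    then show ?thesis
      using that gain_less[of "n - s"] X_nonzero[of "n - s"] by (simp add: y_def vL.vge_def vL.v_divide gain_def)
  qed (simp add: y_def)
  have y0: "y 0 \<in> vL.vge (gain n)"
    using assms X_nonzero[of n] by (simp add: y_def vL.vge_def vL.v_divide gain_def)
  have tX: "app \<tau> (X (n - s)) = X (n - s) * (1 + y s)" if "s \<le> n" for s
    using X_nonzero[of "n - s"] by (simp add: y_def shift_def field_simps)
  have "app \<tau> (monomial N) = (\<Prod>s\<le>n. X (n - s) ^ digit N s * (1 + y s) ^ digit N s)"
    by (simp add: monomial_def \<tau>.hom_prod \<tau>.hom_power tX power_mult_distrib)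
  also have "\<dots> = monomial N * (\<Prod>s\<le>n. (1 + y s) ^ digit N s)"
    by (simp add: monomial_def prod.distrib)
  also have "{..n} = insert 0 {1..n}"
    by auto
  finally have eq: "app \<tau> (monomial N) = monomial N * ((1 + y 0) ^ digit N 0 * u)"
    by (simp add: u_def)
  have "(1 + y s) ^ digit N s \<in> vL.principal_units (gain n + 1)" if "s \<in> {1..n}" for s
  proof -
    have "1 + y s \<in> vL.principal_units (gain n + 1)"
      using y[of s] that by (simp add: vL.principal_units_def)
    then have "(\<Prod>i<digit N s. 1 + y s) \<in> vL.principal_units (gain n + 1)"
      using g by (intro vL.principal_units_prod) auto
    then show ?thesis
      by simp
  qed
  then have u: "u - 1 \<in> vL.vge (gain n + 1)"
    using vL.principal_units_prod[of "{1..n}" _ "gain n + 1"] g by (simp add: u_def vL.principal_units_def)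
  have p0: "(1 + y 0) ^ digit N 0 - 1 - of_nat (digit N 0) * y 0 \<in> vL.vge (gain n + 1)"
    using vL.power_one_plus[OF y0 g] .
  have "1 + y 0 \<in> vL.vge 0"
    using vL.vge_add[OF vL.vge_self[of 1] vL.vge_mono[OF y0]] g by (simp add: vL.v_one)
  then have "(1 + y 0) ^ digit N 0 * (u - 1) \<in> vL.vge (gain n + 1)"
    using vL.vge_mult[OF vL.vge_power[of "1 + y 0" 0] u] by simp
  then have "(1 + y 0) ^ digit N 0 - 1 - of_nat (digit N 0) * y 0 + (1 + y 0) ^ digit N 0 * (u - 1) \<in> vL.vge (gain n + 1)"
    by (rule vL.vge_add[OF p0])
  then have "monomial N * ((1 + y 0) ^ digit N 0 - 1 - of_nat (digit N 0) * y 0 + (1 + y 0) ^ digit N 0 * (u - 1))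
    \<in> vL.vge (vL (monomial N) + (gain n + 1))"
    by (rule vL.vge_mult[OF vL.vge_self])
  moreover have "monomial N * ((1 + y 0) ^ digit N 0 - 1 - of_nat (digit N 0) * y 0 + (1 + y 0) ^ digit N 0 * (u - 1))
    = app \<tau> (monomial N) - monomial N - of_nat (digit N 0) * (shift n / X n) * monomial N"
    unfolding eq by (simp add: y_def algebra_simps)
  ultimately show ?thesis
    by (simp add: add.assoc)
qed

text \<open>Every monomial gains at least \<open>gain n\<close>, and exactly that if its digit 0 is
  nonzero. The leading monomial, with number m, has valuation - m b modulo p, so the hypothesis on
  \<open>vL z\<close> makes its digit 0 nonzero.\<close>

lemma v_galois_diff:
  assumes z: "z \<noteq> 0" "\<not> int p dvd vL z" and nz: "shift n \<noteq> 0"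
  shows "app \<tau> z - z \<noteq> 0" "vL (app \<tau> z - z) = vL z + gain n"
proof -
  obtain c m where c: "z = (\<Sum>N<deg. \<iota> (c N) * monomial N)" "m < deg" "c m \<noteq> 0"
    "vL (\<iota> (c m) * monomial m) = vL z"
    "\<And>N. N < deg \<Longrightarrow> N \<noteq> m \<Longrightarrow> c N \<noteq> 0 \<Longrightarrow> vL z < vL (\<iota> (c N) * monomial N)"
    "[vL z = vL (monomial m)] (mod int deg)"
    using expansion[of monomial z] monomial_nonzero monomial_distinct z(1) by blast
  define t where "t N = app \<tau> (monomial N) - monomial N" for N
  define y where "y = shift n / X n"
  define e where "e N = of_nat (digit N 0) * y * monomial N" for N
  have ratio: "y \<noteq> 0" "vL y = gain n"
    using nz X_nonzero[of n] by (simp_all add: y_def gain_def vL.v_divide)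
  have e_vge: "e N \<in> vL.vge (vL (monomial N) + gain n)" for N
    using vL.vge_mult[OF vL.vge_mult[OF vL.of_nat_vge_0 vL.vge_self[of y]] vL.vge_self[of "monomial N"]]
    by (simp add: e_def ratio add.commute)
  have rest: "t N - e N \<in> vL.vge (vL (monomial N) + gain n + 1)" for N
    using galois_monomial[OF nz, of N] by (simp add: t_def e_def y_def)
  have t_vge: "t N \<in> vL.vge (vL (monomial N) + gain n)" for N
    using vL.vge_add[OF e_vge[of N] vL.vge_mono[OF rest[of N]]] by simp
  have "int p dvd int deg"
    by (simp add: deg_def)
  then have "[vL z = - (int m * b)] (mod int p)"
    using cong_trans[OF c(6) v_monomial_cong[OF c(2)]] cong_dvd_modulus by blast
  then have "\<not> int p dvd int m"
    using z(2) cong_dvd_iff[of "vL z" "- (int m * b)" "int p"] by auto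
  then have d0: "\<not> p dvd digit m 0"
    by (simp add: digit_def dvd_mod_iff)
  then have of_nat0: "(of_nat (digit m 0) :: 'l) \<noteq> 0" "vL (of_nat (digit m 0)) = 0"
  proof -
    show nz0: "(of_nat (digit m 0) :: 'l) \<noteq> 0"
      using d0 of_nat_eq_0_iff_char_dvd[where 'a = 'l] CHAR_l by simp
    show "vL (of_nat (digit m 0)) = 0"
      using vL.v_fixed_power[OF L.of_nat_power_p nz0] K.p_gt_1 by simp
  qed
  then have e_m: "e m \<noteq> 0" "vL (e m) = vL (monomial m) + gain n"
    using ratio monomial_nonzero[of m] by (simp_all add: e_def vL.v_mult)
  then have t_m: "t m \<noteq> 0" "vL (t m) = vL (monomial m) + gain n"
    using vL.v_add_dominant[OF e_m(1) rest[of m]] by simp_all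
  have sum: "app \<tau> z - z = (\<Sum>N<deg. \<iota> (c N) * t N)"
    unfolding c(1) by (simp add: \<tau>.hom_sum \<tau>.hom_mult galois_fixes[OF \<tau>] t_def sum_subtractf right_diff_distrib)
  have vc: "vL (\<iota> (c N) * monomial N) = vL (\<iota> (c N)) + vL (monomial N)" if "c N \<noteq> 0" for N
    using that monomial_nonzero[of N] by (simp add: vL.v_mult)
  have vm: "vL (\<iota> (c m) * t m) = vL z + gain n"
    using c(3,4) t_m vc[of m] by (simp add: vL.v_mult)
  have "vL (\<iota> (c m) * t m) < vL (\<iota> (c N) * t N)" if "N \<in> {..<deg}" "N \<noteq> m" "\<iota> (c N) * t N \<noteq> 0" for N
    using that c(5)[of N] vc[of N] t_vge[of N] unfolding vm by (auto simp: vL.v_mult vL.vge_def)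
  then show "app \<tau> z - z \<noteq> 0" "vL (app \<tau> z - z) = vL z + gain n"
    unfolding sum using vL.sum_dominant[of "{..<deg}" m "\<lambda>N. \<iota> (c N) * t N"] c(2,3) t_m vm by auto
qed

text \<open>A nonzero increment would propagate up to index \<open>n\<close>, so all increments
  vanish and \<tau> fixes a basis of L.\<close>

lemma galois_trivial:
  assumes "shift n = 0"
  shows "app \<tau> z = z"
proof -
  have "shift i = 0" if "i \<le> n" for i
    using shift_nonzero_mono[of i n] assms that by blast
  then have "app \<tau> (X (n - s)) = X (n - s)" for s
    by (simp add: shift_def)
  then have "app \<tau> (monomial N) = monomial N" for N
    by (simp add: monomial_def \<tau>.hom_prod \<tau>.hom_power)
  moreover obtain c where "z = (\<Sum>N<deg. \<iota> (c N) * monomial N)"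
    using expansion_exists[of monomial z] monomial_nonzero monomial_distinct by blast
  ultimately show ?thesis
    by (simp add: \<tau>.hom_sum \<tau>.hom_mult galois_fixes[OF \<tau>])
qed

lemma v_galois_uniformizer_le:
  assumes "is_uniformizer vL \<pi>" "app \<tau> \<pi> - \<pi> \<noteq> 0"
  shows "vL (app \<tau> \<pi> - \<pi>) \<le> lower_break n + 1"
proof -
  have nz: "shift n \<noteq> 0"
    using galois_trivial assms(2) by auto
  have "vL (app \<tau> \<pi> - \<pi>) = 1 + gain n"
    using v_galois_diff(2)[OF _ _ nz, of \<pi>] assms(1) K.p_gt_1 by (simp add: is_uniformizer_def)
  moreover have "gain n \<le> lower_break n"
    using v_shift_nonpos[OF order_refl nz] v_X[of n] by (simp add: gain_def)
  ultimately show ?thesis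
    by simp
qed

end

text \<open>Up to stage \<open>i \<le> k\<close> the elimination subtracts K-multiples of
  \<open>X 0, ..., X (k - 1)\<close>, which are fixed, so the increments of the \<open>x j\<close>
  survive.\<close>

lemma galois_X_iter:
  assumes "\<tau> \<in> galois_group \<iota>" "app \<tau> (x k) = x k + 1" "\<And>j. j \<le> n \<Longrightarrow> j \<noteq> k \<Longrightarrow> app \<tau> (x j) = x j"
  shows "i \<le> j \<Longrightarrow> j \<le> n \<Longrightarrow> i \<le> k \<Longrightarrow> app \<tau> (X_iter i j) = X_iter i j + (if j = k then 1 else 0)"
proof -
  interpret \<tau>: field_hom "app \<tau>"
    by (rule app_hom)
  show "i \<le> j \<Longrightarrow> j \<le> n \<Longrightarrow> i \<le> k \<Longrightarrow> app \<tau> (X_iter i j) = X_iter i j + (if j = k then 1 else 0)"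
    by (induction i arbitrary: j)
      (use assms(2,3) in \<open>auto simp: \<tau>.hom_minus \<tau>.hom_mult galois_fixes[OF assms(1)]\<close>)
qed

text \<open>Here \<tau> is \<sigma>_n. It moves \<open>X n\<close> by 1, an increment of the largest
  possible valuation, and so attains the bound that \<open>v_galois_uniformizer_le\<close> gives for
  all nontrivial automorphisms.\<close>

lemma largest_lower_break_unique:
  assumes \<tau>: "\<tau> \<in> galois_group \<iota>" "app \<tau> (x n) = x n + 1" "\<And>j. j \<le> n \<Longrightarrow> j \<noteq> n \<Longrightarrow> app \<tau> (x j) = x j"
    and \<pi>: "is_uniformizer vL \<pi>" and bm: "is_largest_lower_break \<iota> vL \<pi> bm"
  shows "bm = lower_break n"
proof -
  have "app \<tau> (X n) = X n + 1"
    using galois_X_iter[OF \<tau>, of n n] by simp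
  then have shift: "shift \<tau> n = 1"
    by (simp add: shift_def[OF \<tau>(1)])
  have "app \<tau> \<pi> - \<pi> \<noteq> 0 \<and> vL (app \<tau> \<pi> - \<pi>) = 1 + gain \<tau> n"
    using v_galois_diff[OF \<tau>(1), of \<pi>] shift \<pi> K.p_gt_1 by (simp add: is_uniformizer_def)
  then have v: "app \<tau> \<pi> - \<pi> \<noteq> 0" "vL (app \<tau> \<pi> - \<pi>) = lower_break n + 1"
    using v_X[of n] by (simp_all add: gain_def[OF \<tau>(1)] shift vL.v_one)
  have "is_lower_break \<iota> vL \<pi> (lower_break n)"
  proof -
    have "\<tau> \<in> lower_ramification_group \<iota> vL \<pi> (lower_break n)"
      "\<tau> \<notin> lower_ramification_group \<iota> vL \<pi> (lower_break n + 1)"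
      using v \<tau>(1) by (simp_all add: lower_ramification_group_def)
    then show ?thesis
      unfolding is_lower_break_def by metis
  qed
  then have ge: "lower_break n \<le> bm"
    using bm by (simp add: is_largest_lower_break_def)
  \<comment> \<open>The filtration decreases, so a jump at \<open>bm\<close> yields an element that
    lies in the group at \<open>bm\<close> but not in the next one.\<close>
  have "lower_ramification_group \<iota> vL \<pi> (bm + 1) \<subseteq> lower_ramification_group \<iota> vL \<pi> bm"
    by (auto simp: lower_ramification_group_def)
  moreover have "lower_ramification_group \<iota> vL \<pi> bm \<noteq> lower_ramification_group \<iota> vL \<pi> (bm + 1)"
    using bm by (simp add: is_largest_lower_break_def is_lower_break_def)
  ultimately obtain \<upsilon> where "\<upsilon> \<in> lower_ramification_group \<iota> vL \<pi> bm"
    "\<upsilon> \<notin> lower_ramification_group \<iota> vL \<pi> (bm + 1)"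
    by blast
  then have "\<upsilon> \<in> galois_group \<iota>" "app \<upsilon> \<pi> - \<pi> \<noteq> 0" "vL (app \<upsilon> \<pi> - \<pi>) \<ge> bm + 1"
    by (auto simp: lower_ramification_group_def)
  then have "bm \<le> lower_break n"
    using v_galois_uniformizer_le[of \<upsilon> \<pi>] \<pi> by simp
  then show ?thesis
    using ge by simp
qed

end

section \<open>Binomial coefficients and truncated exponentials\<close>

text \<open>Vandermonde's identity for rising factorials holds over every commutative ring, in
  particular in characteristic p.\<close>

lemma prod_diff_of_nat: "(\<Prod>i<k. y - of_nat i) = (- 1) ^ k * pochhammer (- y :: 'a::comm_ring_1) k"
  by (induction k) (simp_all add: pochhammer_Suc algebra_simps)

lemma binom_pochhammer: "binom y k = (- 1) ^ k * pochhammer (- y) k / of_nat (fact k)"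
  by (simp add: binom_def prod_diff_of_nat)

lemma binom_0 [simp]: "binom y 0 = 1"
  by (simp add: binom_def)

context char_p_field
begin

lemma of_nat_fact_nonzero:
  assumes "k < p"
  shows "(of_nat (fact k) :: 'a) \<noteq> 0"
proof -
  have "\<not> p dvd fact k"
    using prime_dvd_fact_iff[OF prime_p] assms by simp
  then show ?thesis
    using of_nat_eq_0_iff_char_dvd[where 'a = 'a] CHAR_p by simp
qed

text \<open>Vandermonde's identity; the bound \<open>m < p\<close> keeps the factorials in the
  denominators invertible.\<close>

lemma binom_add:
  assumes "m < p"
  shows "binom (y + z :: 'a) m = (\<Sum>k\<le>m. binom y k * binom z (m - k))"
proof -
  have "(- 1) ^ m * pochhammer (- (y + z)) m / of_nat (fact m) =
      (\<Sum>k\<le>m. (- 1) ^ m * (of_nat (m choose k) * pochhammer (- y) k * pochhammer (- z) (m - k)) / of_nat (fact m))"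
    using pochhammer_binomial_sum[of "- y" "- z" m] by (simp add: sum_distrib_left sum_divide_distrib)
  also have "\<dots> = (\<Sum>k\<le>m. binom y k * binom z (m - k))"
  proof (intro sum.cong refl)
    fix k assume "k \<in> {..m}"
    then have k: "k \<le> m"
      by simp
    have "(of_nat (fact m) :: 'a) = of_nat (fact k) * of_nat (fact (m - k)) * of_nat (m choose k)"
      using binomial_fact_lemma[OF k] by (simp only: of_nat_mult[symmetric])
    moreover have "(of_nat (fact k) :: 'a) \<noteq> 0" "(of_nat (fact (m - k)) :: 'a) \<noteq> 0" "(of_nat (fact m) :: 'a) \<noteq> 0"
      using k assms by (auto intro!: of_nat_fact_nonzero simp del: of_nat_fact)
    moreover have "(- 1 :: 'a) ^ m = (- 1) ^ k * (- 1) ^ (m - k)"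
      using k by (simp add: power_add[symmetric])
    ultimately show "(- 1) ^ m * (of_nat (m choose k) * pochhammer (- y) k * pochhammer (- z) (m - k)) / of_nat (fact m)
        = binom y k * binom z (m - k)"
      unfolding binom_pochhammer by (simp add: field_simps del: of_nat_fact)
  qed
  finally show ?thesis
    by (simp only: binom_pochhammer)
qed

lemma binom_add_one:
  assumes "Suc m < p"
  shows "binom (y + 1 :: 'a) (Suc m) = binom y (Suc m) + binom y m"
proof -
  have one: "binom (1 :: 'a) k = (if k \<le> 1 then 1 else 0)" for k
  proof (cases "k \<le> 1")
    case True
    then show ?thesis
      by (cases k) (auto simp: binom_def)
  next
    case False
    then have "(\<Prod>i<k. 1 - of_nat i :: 'a) = 0"
      by (intro prod_zero) (auto intro!: bexI[of _ 1])
    then show ?thesis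
      using False by (simp add: binom_def)
  qed
  have "binom (1 + y) (Suc m) = (\<Sum>k\<in>{0, 1}. binom 1 k * binom y (Suc m - k))"
    unfolding binom_add[OF assms] by (intro sum.mono_neutral_right) (auto simp: one)
  then show ?thesis
    by (simp add: one add.commute)
qed

end

lemma (in field_hom) hom_binom: "hom (binom y k) = binom (hom y) k"
  by (simp add: binom_def hom_distribs)

section \<open>The action of the group algebra\<close>

lemma poly_mapping_eq_sum_single: "\<theta> = (\<Sum>k\<in>Poly_Mapping.keys \<theta>. Poly_Mapping.single k (Poly_Mapping.lookup \<theta> k))"
  by (rule poly_mapping_eqI) (simp add: lookup_sum lookup_single when_def in_keys_iff)

lemma app_zero: "app (0 :: 'l::field field_auto) = id"
proof -
  have "field_hom (id :: 'l \<Rightarrow> 'l)"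
    by unfold_locales auto
  then show ?thesis
    by (simp add: zero_field_auto_def Abs_field_auto_inverse)
qed

lemma app_plus: "app (\<sigma> + \<tau>) = app \<sigma> \<circ> app (\<tau> :: 'l::field field_auto)"
proof -
  interpret s: field_hom "app \<sigma>"
    by (rule app_hom)
  interpret t: field_hom "app \<tau>"
    by (rule app_hom)
  have "field_hom (app \<sigma> \<circ> app \<tau>)"
    by unfold_locales (auto simp: s.hom_add t.hom_add s.hom_mult t.hom_mult)
  moreover have "bij (app \<sigma> \<circ> app \<tau>)"
    using app[of \<sigma>] app[of \<tau>] by (auto intro: bij_comp)
  ultimately show ?thesis
    by (simp add: plus_field_auto_def Abs_field_auto_inverse)
qed

locale galois_action = field_hom \<iota> for \<iota> :: "'k::field fls \<Rightarrow> 'l::field"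
begin

lemma act_superset:
  assumes "finite S" "Poly_Mapping.keys \<theta> \<subseteq> S"
  shows "act \<iota> \<theta> z = (\<Sum>\<tau>\<in>S. \<iota> (Poly_Mapping.lookup \<theta> \<tau>) * app \<tau> z)"
  unfolding act_def using assms by (intro sum.mono_neutral_left) (auto simp: in_keys_iff)

lemma act_add: "act \<iota> (\<theta> + \<eta>) z = act \<iota> \<theta> z + act \<iota> \<eta> z"
proof -
  let ?S = "Poly_Mapping.keys \<theta> \<union> Poly_Mapping.keys \<eta> \<union> Poly_Mapping.keys (\<theta> + \<eta>)"
  have S: "finite ?S"
    by simp
  show ?thesis
    by (subst (1 2 3) act_superset[OF S]) (auto simp: lookup_add hom_distribs distrib_right sum.distrib)
qed

lemma act_zero: "act \<iota> 0 z = 0"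
  by (simp add: act_def)

lemma act_sum: "act \<iota> (\<Sum>i\<in>I. f i) z = (\<Sum>i\<in>I. act \<iota> (f i) z)"
  by (induction I rule: infinite_finite_induct) (simp_all add: act_zero act_add)

lemma act_diff: "act \<iota> (\<theta> - \<eta>) z = act \<iota> \<theta> z - act \<iota> \<eta> z"
  using act_add[of "\<theta> - \<eta>" \<eta> z] by simp

lemma act_single: "act \<iota> (Poly_Mapping.single \<tau> c) z = \<iota> c * app \<tau> z"
  by (simp add: act_def)

lemma act_scalar: "act \<iota> (scalar c) z = \<iota> c * z"
  by (simp add: act_single app_zero)

lemma act_one: "act \<iota> 1 z = z"
  using act_scalar[of 1 z] by simp

definition KG :: "('l field_auto \<Rightarrow>\<^sub>0 'k fls) set" where
  "KG = {\<theta>. Poly_Mapping.keys \<theta> \<subseteq> galois_group \<iota>}"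

lemma app_linear:
  assumes "\<tau> \<in> galois_group \<iota>"
  shows "app \<tau> (\<Sum>i\<in>I. \<iota> (c i) * f i) = (\<Sum>i\<in>I. \<iota> (c i) * app \<tau> (f i))"
proof -
  interpret t: field_hom "app \<tau>"
    by (rule app_hom)
  show ?thesis
    using assms by (simp add: t.hom_sum t.hom_mult galois_group_def)
qed

text \<open>The automorphisms in \<theta> are moved past the coefficients of \<eta> and must fix
  them, hence the membership of \<theta> in K[G].\<close>

lemma act_mult:
  assumes "\<theta> \<in> KG"
  shows "act \<iota> (\<theta> * \<eta>) z = act \<iota> \<theta> (act \<iota> \<eta> z)"
proof -
  let ?a = "Poly_Mapping.lookup \<theta>" and ?b = "Poly_Mapping.lookup \<eta>"
  have "\<theta> * \<eta> = (\<Sum>k\<in>Poly_Mapping.keys \<theta>. Poly_Mapping.single k (?a k)) * (\<Sum>l\<in>Poly_Mapping.keys \<eta>. Poly_Mapping.single l (?b l))"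
    using poly_mapping_eq_sum_single[of \<theta>] poly_mapping_eq_sum_single[of \<eta>] by simp
  also have "\<dots> = (\<Sum>k\<in>Poly_Mapping.keys \<theta>. \<Sum>l\<in>Poly_Mapping.keys \<eta>. Poly_Mapping.single (k + l) (?a k * ?b l))"
    by (simp add: sum_product mult_single)
  finally have "act \<iota> (\<theta> * \<eta>) z =
      (\<Sum>k\<in>Poly_Mapping.keys \<theta>. \<Sum>l\<in>Poly_Mapping.keys \<eta>. \<iota> (?a k * ?b l) * app (k + l) z)"
    by (simp only: act_sum act_single)
  also have "\<dots> = (\<Sum>k\<in>Poly_Mapping.keys \<theta>. \<iota> (?a k) * app k (\<Sum>l\<in>Poly_Mapping.keys \<eta>. \<iota> (?b l) * app l z))"
  proof (rule sum.cong[OF refl])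
    fix k assume "k \<in> Poly_Mapping.keys \<theta>"
    then have "k \<in> galois_group \<iota>"
      using assms by (auto simp: KG_def)
    then show "(\<Sum>l\<in>Poly_Mapping.keys \<eta>. \<iota> (?a k * ?b l) * app (k + l) z)
        = \<iota> (?a k) * app k (\<Sum>l\<in>Poly_Mapping.keys \<eta>. \<iota> (?b l) * app l z)"
      by (simp add: app_linear app_plus hom_mult sum_distrib_left mult.assoc)
  qed
  finally show ?thesis
    by (simp add: act_def)
qed

lemma act_linear:
  assumes "\<theta> \<in> KG"
  shows "act \<iota> \<theta> (\<Sum>i\<in>I. \<iota> (c i) * f i) = (\<Sum>i\<in>I. \<iota> (c i) * act \<iota> \<theta> (f i))"
proof -
  have "act \<iota> \<theta> (\<Sum>i\<in>I. \<iota> (c i) * f i) =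
      (\<Sum>\<tau>\<in>Poly_Mapping.keys \<theta>. \<Sum>i\<in>I. \<iota> (c i) * (\<iota> (Poly_Mapping.lookup \<theta> \<tau>) * app \<tau> (f i)))"
    unfolding act_def using assms
    by (intro sum.cong refl) (auto simp: app_linear KG_def sum_distrib_left mult.left_commute)
  also have "\<dots> = (\<Sum>i\<in>I. \<iota> (c i) * act \<iota> \<theta> (f i))"
    unfolding act_def by (subst sum.swap) (simp add: sum_distrib_left)
  finally show ?thesis .
qed

lemma act_scale: "\<theta> \<in> KG \<Longrightarrow> act \<iota> \<theta> (\<iota> c * z) = \<iota> c * act \<iota> \<theta> z"
  using act_linear[of \<theta> "\<lambda>_. c" "\<lambda>_. z" "{0 :: nat}"] by simp

lemma act_0: "\<theta> \<in> KG \<Longrightarrow> act \<iota> \<theta> 0 = 0"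
  using act_scale[of \<theta> 0 0] by simp

lemma KG_add: "\<theta> \<in> KG \<Longrightarrow> \<eta> \<in> KG \<Longrightarrow> \<theta> + \<eta> \<in> KG"
  using keys_add[of \<theta> \<eta>] by (auto simp: KG_def)

lemma KG_zero: "0 \<in> KG"
  by (simp add: KG_def)

lemma KG_sum: "(\<And>i. i \<in> I \<Longrightarrow> f i \<in> KG) \<Longrightarrow> (\<Sum>i\<in>I. f i) \<in> KG"
  by (induction I rule: infinite_finite_induct) (simp_all add: KG_zero KG_add)

lemma KG_uminus: "\<theta> \<in> KG \<Longrightarrow> - \<theta> \<in> KG"
  by (auto simp: KG_def in_keys_iff)

lemma KG_diff: "\<theta> \<in> KG \<Longrightarrow> \<eta> \<in> KG \<Longrightarrow> \<theta> - \<eta> \<in> KG"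
  using KG_add[OF _ KG_uminus] by fastforce

lemma KG_single: "\<tau> \<in> galois_group \<iota> \<Longrightarrow> Poly_Mapping.single \<tau> c \<in> KG"
  by (simp add: KG_def)

lemma KG_scalar: "scalar c \<in> KG"
  by (intro KG_single) (simp add: galois_group_def app_zero)

lemma KG_one: "1 \<in> KG"
  using KG_scalar[of 1] by simp

lemma KG_mult: "\<theta> \<in> KG \<Longrightarrow> \<eta> \<in> KG \<Longrightarrow> \<theta> * \<eta> \<in> KG"
proof -
  assume "\<theta> \<in> KG" "\<eta> \<in> KG"
  moreover have "\<sigma> + \<tau> \<in> galois_group \<iota>" if "\<sigma> \<in> galois_group \<iota>" "\<tau> \<in> galois_group \<iota>" for \<sigma> \<tau>
    using that by (simp add: galois_group_def app_plus)
  ultimately show ?thesis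
    using keys_mult[of \<theta> \<eta>] by (force simp: KG_def)
qed

lemma KG_power: "\<theta> \<in> KG \<Longrightarrow> \<theta> ^ k \<in> KG"
  by (induction k) (simp_all add: KG_one KG_mult)

lemma KG_trunc_exp: "\<theta> \<in> KG \<Longrightarrow> trunc_exp q \<theta> c \<in> KG"
  unfolding trunc_exp_def by (intro KG_sum KG_mult KG_scalar KG_power KG_diff KG_one)

lemma KG_prod_list: "(\<And>s. s \<in> set ss \<Longrightarrow> f s \<in> KG) \<Longrightarrow> prod_list (map f ss) \<in> KG"
  by (induction ss) (simp_all add: KG_one KG_mult)

lemma KG_Theta: "(\<And>i. i \<le> n \<Longrightarrow> \<sigma> i \<in> galois_group \<iota>) \<Longrightarrow> Theta p n \<Omega> \<sigma> i \<in> KG"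
proof (induction i rule: less_induct)
  case (less i)
  have "prod_list (map (\<lambda>s. trunc_exp p (Theta p n \<Omega> \<sigma> s) (- Delta p n \<Omega> (n - i) (n - s))) [0..<i]) \<in> KG"
    by (intro KG_prod_list KG_trunc_exp less) auto
  then show ?case
    by (subst Theta.simps) (intro KG_mult KG_single less(2), simp_all)
qed

end

section \<open>The scaffold\<close>

locale near_one_dim_galois = near_one_dim p n \<iota> vL x \<beta> b \<Omega> \<epsilon>
  for p n :: nat
    and \<iota> :: "'k::field fls \<Rightarrow> 'l::field"
    and vL :: "'l \<Rightarrow> int"
    and x :: "nat \<Rightarrow> 'l"
    and \<beta> :: "'k fls"
    and b :: int
    and \<Omega> \<epsilon> :: "nat \<Rightarrow> 'k fls" +
  fixes \<sigma> :: "nat \<Rightarrow> 'l field_auto"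
  assumes \<sigma>_galois: "\<And>i. i \<le> n \<Longrightarrow> \<sigma> i \<in> galois_group \<iota>"
    and \<sigma>_same: "\<And>i. i \<le> n \<Longrightarrow> app (\<sigma> i) (x i) = x i + 1"
    and \<sigma>_other: "\<And>i j. i \<le> n \<Longrightarrow> j \<le> n \<Longrightarrow> j \<noteq> i \<Longrightarrow> app (\<sigma> i) (x j) = x j"
begin

sublocale action: galois_action \<iota>
  by unfold_locales

section \<open>The matrix of the change of generators and the action of the
  \<open>\<sigma> k\<close> on the \<open>X i\<close>\<close>

lemma Omega_phi_entry:
  assumes "i \<le> n" "j \<le> n"
  shows "Omega_phi p n \<Omega> $$ (i, j) = (if j < i then 0 else \<omega> i j ^ (p ^ (n - 1 - i)))"
proof (cases "i = n")
  case True
  \<comment> \<open>Truncated subtraction makes the exponent \<open>p ^ 0\<close>, and the diagonal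
    entry \<open>\<omega> n n\<close> is 1, in agreement with the convention for this entry.\<close>
  then show ?thesis
    using assms omega_diag[of n] by (auto simp: Omega_phi_def)
next
  case False
  then show ?thesis
    using assms by (simp add: Omega_phi_def frob_funpow)
qed

lemma Omega_phi_carrier: "Omega_phi p n \<Omega> \<in> carrier_mat (n + 1) (n + 1)"
  by (simp add: Omega_phi_def)

lemma det_Omega_phi: "det (Omega_phi p n \<Omega>) = 1"
proof -
  have "upper_triangular (Omega_phi p n \<Omega>)"
  proof (rule upper_triangularI)
    fix i j assume "j < i" "i < dim_row (Omega_phi p n \<Omega>)"
    then show "Omega_phi p n \<Omega> $$ (i, j) = 0"
      using Omega_phi_carrier Omega_phi_entry[of i j] by simp
  qed
  then have "det (Omega_phi p n \<Omega>) = prod_list (diag_mat (Omega_phi p n \<Omega>))"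
    using Omega_phi_carrier by (rule det_upper_triangular)
  also have "diag_mat (Omega_phi p n \<Omega>) = map (\<lambda>i. 1) [0..<n + 1]"
    unfolding diag_mat_def using Omega_phi_carrier by (auto simp: Omega_phi_entry omega_diag)
  finally show ?thesis
    by (simp add: map_replicate_const)
qed

text \<open>Determinant 1 ensures that \<open>mat_inverse\<close> returns a matrix, so that
  \<open>the\<close> in \<open>Delta\<close> is applied to a genuine value.\<close>

lemma Omega_phi_Delta:
  assumes "l \<le> n" "i \<le> n"
  shows "(\<Sum>j\<le>n. Omega_phi p n \<Omega> $$ (l, j) * Delta p n \<Omega> j i) = (if l = i then 1 else 0)"
proof -
  let ?M = "Omega_phi p n \<Omega>"
  have "?M \<in> Units (ring_mat TYPE('k fls) (n + 1) ())"
    using det_non_zero_imp_unit[OF Omega_phi_carrier] det_Omega_phi by simp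
  then obtain W where W: "mat_inverse ?M = Some W"
    using mat_inverse(1)[OF Omega_phi_carrier, where b = "()"] by (cases "mat_inverse ?M") auto
  have MW: "?M * W = 1\<^sub>m (n + 1)" "W \<in> carrier_mat (n + 1) (n + 1)"
    using mat_inverse(2)[OF Omega_phi_carrier W] by auto
  have "(?M * W) $$ (l, i) = (\<Sum>j\<le>n. ?M $$ (l, j) * W $$ (j, i))"
    using MW(2) Omega_phi_carrier assms
    by (simp add: scalar_prod_def atLeast0LessThan lessThan_Suc_atMost del: sum.op_ivl_Suc)
  then show ?thesis
    unfolding MW(1) using assms by (simp add: Delta_def W)
qed

lemma x_eq_sum_X: "j \<le> n \<Longrightarrow> x j = (\<Sum>i\<le>n. \<iota> (Omega_phi p n \<Omega> $$ (i, j)) * X i)"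
proof -
  assume j: "j \<le> n"
  have "X_iter i j = x j - (\<Sum>k<i. \<iota> (\<omega> k j ^ (p ^ (n - 1 - k))) * X k)" for i
    by (induction i) simp_all
  then have "x j = X j + (\<Sum>k<j. \<iota> (\<omega> k j ^ (p ^ (n - 1 - k))) * X k)"
    by simp
  also have "\<dots> = (\<Sum>k\<le>j. \<iota> (\<omega> k j ^ (p ^ (n - 1 - k))) * X k)"
    using omega_diag[OF j] by (simp add: lessThan_Suc_atMost[symmetric] add.commute)
  also have "\<dots> = (\<Sum>k\<le>j. \<iota> (Omega_phi p n \<Omega> $$ (k, j)) * X k)"
    using j by (intro sum.cong) (auto simp: Omega_phi_entry)
  also have "\<dots> = (\<Sum>k\<le>n. \<iota> (Omega_phi p n \<Omega> $$ (k, j)) * X k)"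
    using j by (intro sum.mono_neutral_left) (auto simp: Omega_phi_entry)
  finally show ?thesis .
qed

text \<open>Applying \<sigma>_k to (x_0, ..., x_n) = (X_0, ..., X_n) [\<Omega>^\<phi>] shows that
  the row \<open>D\<close> of increments times the matrix is the k-th unit row; multiplication by
  the inverse identifies \<open>D\<close> with row k of \<open>Delta\<close>.\<close>

lemma galois_X:
  assumes k: "k \<le> n" and i: "i \<le> n"
  shows "app (\<sigma> k) (X i) = X i + \<iota> (Delta p n \<Omega> k i)"
proof -
  interpret s: field_hom "app (\<sigma> k)"
    by (rule app_hom)
  let ?M = "\<lambda>l j. Omega_phi p n \<Omega> $$ (l, j)" and ?W = "Delta p n \<Omega>"
  define D where "D l = app (\<sigma> k) (X l) - X l" for l
  have rows: "(\<Sum>l\<le>n. \<iota> (?M l j) * D l) = (if j = k then 1 else 0)" if "j \<le> n" for j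
  proof -
    have "(\<Sum>l\<le>n. \<iota> (?M l j) * D l) = app (\<sigma> k) (x j) - x j"
      unfolding x_eq_sum_X[OF that] D_def action.app_linear[OF \<sigma>_galois[OF k]]
      by (simp add: right_diff_distrib sum_subtractf)
    then show ?thesis
      using \<sigma>_same[OF k] \<sigma>_other[OF k that] by (cases "j = k") auto
  qed
  have "D i = (\<Sum>l\<le>n. D l * \<iota> (if l = i then 1 else 0))"
    using i by (simp add: if_distrib[of "\<lambda>c. _ * c"] if_distrib[of \<iota>] cong: if_cong)
  also have "\<dots> = (\<Sum>l\<le>n. D l * \<iota> (\<Sum>j\<le>n. ?M l j * ?W j i))"
    using Omega_phi_Delta i by simp
  also have "\<dots> = (\<Sum>l\<le>n. \<Sum>j\<le>n. \<iota> (?M l j) * D l * \<iota> (?W j i))"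
    by (simp add: hom.hom_sum hom.hom_mult sum_distrib_left mult_ac)
  also have "\<dots> = (\<Sum>j\<le>n. (\<Sum>l\<le>n. \<iota> (?M l j) * D l) * \<iota> (?W j i))"
    by (subst sum.swap) (simp add: sum_distrib_right)
  also have "\<dots> = (\<Sum>j\<le>n. if j = k then \<iota> (?W j i) else 0)"
    by (intro sum.cong) (auto simp: rows)
  also have "\<dots> = \<iota> (?W k i)"
    using k by simp
  finally show ?thesis
    by (simp add: D_def algebra_simps)
qed

lemma galois_X_less: "k \<le> n \<Longrightarrow> i < k \<Longrightarrow> app (\<sigma> k) (X i) = X i"
  using galois_X_iter[OF \<sigma>_galois \<sigma>_same \<sigma>_other, of k i i] by simp

lemma galois_X_same: "k \<le> n \<Longrightarrow> app (\<sigma> k) (X k) = X k + 1"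
  using galois_X_iter[OF \<sigma>_galois \<sigma>_same \<sigma>_other, of k k k] by simp

section \<open>Group algebra elements acting on products of binomial coefficients\<close>

definition binom_prod :: "(nat \<Rightarrow> 'l) \<Rightarrow> (nat \<Rightarrow> nat) \<Rightarrow> 'l" where
  "binom_prod y e = (\<Prod>s\<le>n. binom (y s) (e s))"

lemma binom_prod_split: "s \<le> n \<Longrightarrow> binom_prod y e = binom (y s) (e s) * (\<Prod>t\<in>{..n} - {s}. binom (y t) (e t))"
  unfolding binom_prod_def by (simp add: prod.remove)

lemma binom_prod_upd:
  assumes "s \<le> n" "\<And>t. t \<noteq> s \<Longrightarrow> y' t = y t" "\<And>t. t \<noteq> s \<Longrightarrow> e' t = e t"
  shows "binom_prod y' e' = binom (y' s) (e' s) * (\<Prod>t\<in>{..n} - {s}. binom (y t) (e t))"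
  unfolding binom_prod_split[OF assms(1)] using assms(2,3) by (intro arg_cong2[of _ _ _ _ times] refl prod.cong) auto

definition shifts :: "(nat \<Rightarrow> 'l) set" where
  "shifts = {y. \<exists>c. y = (\<lambda>s. X (n - s) + \<iota> (c s))}"

text \<open>
  The shifts by constants of \<open>K\<close> have to be included for the induction on \<open>s\<close>: \<open>\<Theta>\<^bsub>(s)\<^esub>\<close> is applied to
  products some of whose factors have already been shifted.
\<close>

definition raises :: "('l field_auto \<Rightarrow>\<^sub>0 'k fls) \<Rightarrow> nat \<Rightarrow> bool" where
  "raises \<theta> s \<longleftrightarrow> (\<forall>y\<in>shifts. \<forall>e. (\<forall>t\<le>n. e t < p) \<longrightarrow>
     act \<iota> \<theta> (binom_prod y e) = binom_prod (y(s := y s + 1)) e)"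

text \<open>Pascal's rule in coordinate \<open>s\<close>; with exponent 0 the factor is constant and
  the difference vanishes.\<close>

lemma act_minus_one:
  assumes "raises \<theta> s" "s \<le> n" "y \<in> shifts" "\<forall>t\<le>n. e t < p"
  shows "act \<iota> (\<theta> - 1) (binom_prod y e) = (if e s = 0 then 0 else binom_prod y (e(s := e s - 1)))"
proof -
  have eq: "act \<iota> (\<theta> - 1) (binom_prod y e) = binom_prod (y(s := y s + 1)) e - binom_prod y e"
    using assms by (simp add: action.act_diff action.act_one raises_def)
  show ?thesis
  proof (cases "e s")
    case 0
    then show ?thesis
      unfolding eq using assms(2) by (simp add: binom_prod_upd[of s _ y _ e] binom_prod_split[of s y e])
  next
    case (Suc m)
    have "Suc m < p"
      using assms(2,4) Suc by metis
    then have "binom (y s + 1) (Suc m) - binom (y s) (Suc m) = binom (y s) m"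
      by (simp add: L.binom_add_one)
    moreover have "binom_prod (y(s := y s + 1)) e - binom_prod y e =
        (binom (y s + 1) (Suc m) - binom (y s) (Suc m)) * (\<Prod>t\<in>{..n} - {s}. binom (y t) (e t))"
      using assms(2) Suc by (simp add: binom_prod_upd[of s "y(s := y s + 1)" y e e] binom_prod_split[of s y e] left_diff_distrib)
    moreover have "binom_prod y (e(s := m)) = binom (y s) m * (\<Prod>t\<in>{..n} - {s}. binom (y t) (e t))"
      using binom_prod_upd[of s y y "e(s := m)" e] assms(2) by simp
    ultimately show ?thesis
      unfolding eq using Suc by simp
  qed
qed

lemma act_minus_one_power:
  assumes "\<theta> \<in> action.KG" "raises \<theta> s" "s \<le> n" "y \<in> shifts" "\<forall>t\<le>n. e t < p"
  shows "act \<iota> ((\<theta> - 1) ^ k) (binom_prod y e) = (if k \<le> e s then binom_prod y (e(s := e s - k)) else 0)"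
proof (induction k)
  case 0
  then show ?case
    by (simp add: action.act_one)
next
  case (Suc k)
  have KG: "\<theta> - 1 \<in> action.KG"
    using assms(1) by (intro action.KG_diff action.KG_one)
  have "act \<iota> ((\<theta> - 1) ^ Suc k) (binom_prod y e) = act \<iota> (\<theta> - 1) (act \<iota> ((\<theta> - 1) ^ k) (binom_prod y e))"
    using action.act_mult[OF KG] by simp
  also have "\<dots> = (if Suc k \<le> e s then binom_prod y (e(s := e s - Suc k)) else 0)"
  proof (cases "k \<le> e s")
    case True
    have "\<forall>t\<le>n. (e(s := e s - k)) t < p"
      using assms(5) by (auto intro: order.strict_trans1)
    then show ?thesis
      using act_minus_one[OF assms(2,3,4), of "e(s := e s - k)"] True by (auto simp: Suc)
  qed (simp add: Suc action.act_0[OF KG])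
  finally show ?case .
qed

text \<open>Vandermonde's identity in coordinate \<open>s\<close>. Since \<open>e s < p\<close>, the
  truncated sum contains all terms that do not vanish.\<close>

lemma act_trunc_exp:
  assumes "\<theta> \<in> action.KG" "raises \<theta> s" "s \<le> n" "y \<in> shifts" "\<forall>t\<le>n. e t < p"
  shows "act \<iota> (trunc_exp p \<theta> d) (binom_prod y e) = binom_prod (y(s := y s + \<iota> d)) e"
proof -
  let ?R = "\<Prod>t\<in>{..n} - {s}. binom (y t) (e t)"
  have es: "e s < p"
    using assms(3,5) by simp
  have upd: "binom_prod y (e(s := k)) = binom (y s) k * ?R" for k
    using binom_prod_upd[of s y y "e(s := k)" e] assms(3) by simp
  have "act \<iota> (trunc_exp p \<theta> d) (binom_prod y e) =
      (\<Sum>k<p. \<iota> (binom d k) * act \<iota> ((\<theta> - 1) ^ k) (binom_prod y e))"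
    unfolding trunc_exp_def action.act_sum
    by (simp add: action.act_mult[OF action.KG_scalar] action.act_scalar)
  also have "\<dots> = (\<Sum>k<p. if k \<le> e s then binom (\<iota> d) k * (binom (y s) (e s - k) * ?R) else 0)"
    by (simp add: act_minus_one_power[OF assms] hom.hom_binom upd if_distrib[of "\<lambda>z. _ * z"] cong: if_cong)
  also have "\<dots> = (\<Sum>k\<le>e s. binom (\<iota> d) k * (binom (y s) (e s - k) * ?R))"
    using es by (intro sum.mono_neutral_cong_right) auto
  also have "\<dots> = binom (\<iota> d + y s) (e s) * ?R"
    unfolding L.binom_add[OF es] by (simp add: sum_distrib_right mult.assoc)
  also have "\<dots> = binom_prod (y(s := y s + \<iota> d)) e"
    using binom_prod_upd[of s "y(s := y s + \<iota> d)" y e e] assms(3) by (simp add: add.commute)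
  finally show ?thesis .
qed

lemma shifts_upd: "y \<in> shifts \<Longrightarrow> (\<lambda>s. y s + \<iota> (c s)) \<in> shifts"
proof -
  assume "y \<in> shifts"
  then obtain c' where "y = (\<lambda>s. X (n - s) + \<iota> (c' s))"
    by (auto simp: shifts_def)
  then have "(\<lambda>s. y s + \<iota> (c s)) = (\<lambda>s. X (n - s) + \<iota> (c' s + c s))"
    by (simp add: hom.hom_add add.assoc)
  then show ?thesis
    unfolding shifts_def mem_Collect_eq by (intro exI[of _ "\<lambda>s. c' s + c s"])
qed

text \<open>The factor for \<open>s\<close> shifts coordinate \<open>s\<close> alone, so the shifts
  accumulate. The rightmost factor acts first and the induction peels it off, which is why
  \<open>y\<close> has to vary.\<close>

lemma act_trunc_exp_prod:
  assumes "\<And>s. s < i \<Longrightarrow> \<theta> s \<in> action.KG" "\<And>s. s < i \<Longrightarrow> raises (\<theta> s) s" "i \<le> n" "\<forall>t\<le>n. e t < p"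
  shows "y \<in> shifts \<Longrightarrow> act \<iota> (prod_list (map (\<lambda>s. trunc_exp p (\<theta> s) (d s)) [0..<i])) (binom_prod y e)
    = binom_prod (\<lambda>s. y s + \<iota> (if s < i then d s else 0)) e"
  using assms(1-3)
proof (induction i arbitrary: y)
  case 0
  then show ?case
    by (simp add: action.act_one)
next
  case (Suc i)
  let ?y = "y(i := y i + \<iota> (d i))"
  have "?y = (\<lambda>s. y s + \<iota> (if s = i then d i else 0))"
    by auto
  then have y: "?y \<in> shifts"
    using shifts_upd[OF Suc.prems(1)] by simp
  let ?P = "prod_list (map (\<lambda>s. trunc_exp p (\<theta> s) (d s)) [0..<i])"
  have P: "?P \<in> action.KG"
    using Suc.prems by (intro action.KG_prod_list action.KG_trunc_exp) auto
  have "act \<iota> (?P * trunc_exp p (\<theta> i) (d i)) (binom_prod y e) = act \<iota> ?P (binom_prod ?y e)"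
    using act_trunc_exp[of "\<theta> i" i y e "d i"] Suc.prems assms(4) by (simp add: action.act_mult[OF P])
  also have "\<dots> = binom_prod (\<lambda>s. ?y s + \<iota> (if s < i then d s else 0)) e"
    by (rule Suc.IH[OF y]) (use Suc.prems in auto)
  also have "(\<lambda>s. ?y s + \<iota> (if s < i then d s else 0)) = (\<lambda>s. y s + \<iota> (if s < Suc i then d s else 0))"
    by (auto simp: fun_eq_iff less_Suc_eq)
  finally show ?case
    by simp
qed

lemma app_binom_prod: "app \<tau> (binom_prod y e) = binom_prod (\<lambda>s. app \<tau> (y s)) e"
proof -
  interpret t: field_hom "app \<tau>"
    by (rule app_hom)
  show ?thesis
    by (simp add: binom_prod_def t.hom_prod t.hom_binom)
qed

text \<open>For s < i the truncated powers subtract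
  \<open>Delta p n \<Omega> (n - i) (n - s)\<close> from \<open>X (n - s)\<close>, and
  \<open>\<sigma> (n - i)\<close> adds it back. At s = i the automorphism adds 1; for s > i it fixes
  \<open>X (n - s)\<close>.\<close>

lemma Theta_raises: "i \<le> n \<Longrightarrow> raises (Theta p n \<Omega> \<sigma> i) i"
proof (induction i rule: less_induct)
  case (less i)
  define d where "d s = - Delta p n \<Omega> (n - i) (n - s)" for s
  let ?\<tau> = "\<sigma> (n - i)"
  let ?P = "prod_list (map (\<lambda>s. trunc_exp p (Theta p n \<Omega> \<sigma> s) (d s)) [0..<i])"
  have \<tau>: "?\<tau> \<in> galois_group \<iota>"
    by (rule \<sigma>_galois) simp
  interpret t: field_hom "app ?\<tau>"
    by (rule app_hom)
  show ?case
    unfolding raises_def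
  proof (intro ballI allI impI)
    fix y e assume y: "y \<in> shifts" and e: "\<forall>t\<le>n. e t < p"
    obtain c where c: "y = (\<lambda>s. X (n - s) + \<iota> (c s))"
      using y by (auto simp: shifts_def)
    have "act \<iota> ?P (binom_prod y e) = binom_prod (\<lambda>s. y s + \<iota> (if s < i then d s else 0)) e"
      using less y e by (intro act_trunc_exp_prod action.KG_Theta \<sigma>_galois) auto
    then have "act \<iota> (Theta p n \<Omega> \<sigma> i) (binom_prod y e) =
        app ?\<tau> (binom_prod (\<lambda>s. y s + \<iota> (if s < i then d s else 0)) e)"
      by (subst Theta.simps) (simp add: action.act_mult[OF action.KG_single[OF \<tau>]] action.act_single d_def)
    also have "\<dots> = binom_prod (\<lambda>s. app ?\<tau> (y s + \<iota> (if s < i then d s else 0))) e"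
      by (rule app_binom_prod)
    also have "\<dots> = binom_prod (y(i := y i + 1)) e"
      unfolding binom_prod_def
    proof (intro prod.cong refl)
      fix s assume "s \<in> {..n}"
      then have s: "s \<le> n"
        by simp
      have "app ?\<tau> (y s + \<iota> (if s < i then d s else 0)) =
          app ?\<tau> (X (n - s)) + \<iota> (c s) + \<iota> (if s < i then d s else 0)"
        using galois_fixes[OF \<tau>] by (simp add: c t.hom_add)
      also have "\<dots> = (y(i := y i + 1)) s"
      proof (cases s i rule: linorder_cases)
        case less
        then show ?thesis
          using galois_X[of "n - i" "n - s"] by (simp add: c d_def hom.hom_uminus)
      next
        case equal
        then show ?thesis
          using galois_X_same[of "n - i"] by (simp add: c)
      next
        case greater
        then show ?thesis
          using galois_X_less[of "n - i" "n - s"] s by (simp add: c)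
      qed
      finally show "binom (app ?\<tau> (y s + \<iota> (if s < i then d s else 0))) (e s) = binom ((y(i := y i + 1)) s) (e s)"
        by simp
    qed
    finally show "act \<iota> (Theta p n \<Omega> \<sigma> i) (binom_prod y e) = binom_prod (y(i := y i + 1)) e" .
  qed
qed

end

lemma sum_top_digits: "p > 0 \<Longrightarrow> (\<Sum>s\<le>n. (p - 1) * p ^ s) + 1 = (p :: nat) ^ (n + 1)"
  by (induction n) (auto simp: gr0_conv_Suc)

section \<open>The basis of products of binomial coefficients and its valuations\<close>

context near_one_dim_galois
begin

text \<open>\<open>N\<close> must be p^(n+1) - 1. Each digit is at most p - 1, and equality of the
  weighted sums forces equality in every term.\<close>

lemma top_digits:
  assumes "deg dvd N + 1" "N < deg" "s \<le> n"
  shows "digit N s = p - 1"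
proof -
  have "N + 1 = deg"
    using dvd_imp_le[OF assms(1)] assms(2) by simp
  then have "(\<Sum>s\<le>n. digit N s * p ^ s) = (\<Sum>s\<le>n. (p - 1) * p ^ s)"
    using sum_digit[OF assms(2)] sum_top_digits[of p n] K.p_gt_1 by (simp add: deg_def)
  moreover have le: "digit N s * p ^ s \<le> (p - 1) * p ^ s" for s
    using digit_less[of N s] by (intro mult_right_mono) auto
  ultimately have "digit N s * p ^ s = (p - 1) * p ^ s"
    using sum_mono_inv[of "\<lambda>s. digit N s * p ^ s" "{..n}" "\<lambda>s. (p - 1) * p ^ s" s] assms(3) by simp
  then show ?thesis
    using K.p_gt_1 by simp
qed

text \<open>\<open>X (n - s)\<close> has a pole, so subtracting elements of the prime field keeps
  its valuation; the factorial is a nonzero element of the prime field and has valuation 0.\<close>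

lemma v_binom_X:
  assumes "s \<le> n" "e < p"
  shows "binom (X (n - s)) e \<noteq> 0 \<and> vL (binom (X (n - s)) e) = int e * vL (X (n - s))"
proof -
  have f: "X (n - s) - of_nat i \<noteq> 0 \<and> vL (X (n - s) - of_nat i) = vL (X (n - s))" for i
    using vL.v_add_dominant[OF X_nonzero[of "n - s"] vL.vge_uminus[OF vL.of_nat_vge_0[of i]]] v_X_neg[of "n - s"]
    by simp
  have fact: "(of_nat (fact e) :: 'l) \<noteq> 0"
    using L.of_nat_fact_nonzero[OF assms(2)] .
  then have "vL (of_nat (fact e)) = 0"
    by (rule vL.v_fixed_power[OF L.of_nat_power_p _ K.p_gt_1])
  moreover have "vL (\<Prod>i<e. X (n - s) - of_nat i) = int e * vL (X (n - s))"
    using f by (subst vL.v_prod) auto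
  ultimately show ?thesis
    using f fact by (auto simp: binom_def vL.v_divide simp del: of_nat_fact)
qed

definition basis :: "(nat \<Rightarrow> nat) \<Rightarrow> 'l" where
  "basis e = binom_prod (\<lambda>s. X (n - s)) e"

lemma X_shifts: "(\<lambda>s. X (n - s)) \<in> shifts"
  unfolding shifts_def mem_Collect_eq by (intro exI[of _ "\<lambda>_. 0"]) simp

lemma v_basis:
  assumes "\<And>s. s \<le> n \<Longrightarrow> e s < p"
  shows "basis e \<noteq> 0" "vL (basis e) = - (\<Sum>s\<le>n. int (e s) * int p ^ s * lower_break (n - s))"
  unfolding basis_def binom_prod_def
  using v_prod_g[of "\<lambda>s e. binom (X (n - s)) e", OF v_binom_X, of e] assms by simp_all

lemma basis_distinct:
  "N < deg \<Longrightarrow> M < deg \<Longrightarrow> [vL (basis (digit N)) = vL (basis (digit M))] (mod int deg) \<Longrightarrow> N = M"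
  unfolding basis_def binom_prod_def by (rule digit_prod_distinct[OF v_binom_X])

lemma v_basis_cong: "N < deg \<Longrightarrow> [vL (basis (digit N)) = - (int N * b)] (mod int deg)"
  unfolding basis_def binom_prod_def by (rule v_digit_prod_cong[OF v_binom_X])

section \<open>The operator of the theorem and its effect on valuations\<close>

context
  fixes \<alpha> :: "nat \<Rightarrow> 'k fls" and a :: "nat \<Rightarrow> nat"
begin

text \<open>At \<open>i = n + 1\<close> this is the operator of the theorem; the partial products
  serve the induction in \<open>act_scaffold_op\<close>, where the factor of largest index acts
  first.\<close>

definition scaffold_op :: "nat \<Rightarrow> ('l field_auto \<Rightarrow>\<^sub>0 'k fls)" where
  "scaffold_op i = prod_list (map (\<lambda>s. scalar (\<alpha> (n - s) ^ a s) * (Theta p n \<Omega> \<sigma> s - 1) ^ a s) [0..<i])"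

lemma KG_Theta_minus_one: "Theta p n \<Omega> \<sigma> s - 1 \<in> action.KG"
  by (intro action.KG_diff action.KG_Theta \<sigma>_galois action.KG_one)

lemma KG_scaffold_op: "scaffold_op i \<in> action.KG"
  unfolding scaffold_op_def
  by (intro action.KG_prod_list action.KG_mult action.KG_scalar action.KG_power KG_Theta_minus_one)

lemma act_scaffold_op:
  "i \<le> n + 1 \<Longrightarrow> \<forall>t\<le>n. e t < p \<Longrightarrow> act \<iota> (scaffold_op i) (basis e) =
     (if \<forall>s<i. a s \<le> e s then \<iota> (\<Prod>s<i. \<alpha> (n - s) ^ a s) * basis (\<lambda>s. if s < i then e s - a s else e s) else 0)"
proof (induction i arbitrary: e)
  case 0
  then show ?case
    by (simp add: scaffold_op_def action.act_one)
next
  case (Suc i)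
  let ?e = "e(i := e i - a i)"
  let ?c = "\<alpha> (n - i) ^ a i" and ?D = "Theta p n \<Omega> \<sigma> i - 1"
  have D: "act \<iota> (?D ^ a i) (basis e) = (if a i \<le> e i then basis ?e else 0)"
    unfolding basis_def
    using Suc.prems by (intro act_minus_one_power action.KG_Theta \<sigma>_galois Theta_raises X_shifts) auto
  have "scaffold_op (Suc i) = scaffold_op i * (scalar ?c * ?D ^ a i)"
    by (simp add: scaffold_op_def)
  then have "act \<iota> (scaffold_op (Suc i)) (basis e) = act \<iota> (scaffold_op i) (\<iota> ?c * act \<iota> (?D ^ a i) (basis e))"
    by (simp add: action.act_mult[OF KG_scaffold_op] action.act_mult[OF action.KG_scalar] action.act_scalar)
  also have "\<dots> = \<iota> ?c * (if a i \<le> e i then act \<iota> (scaffold_op i) (basis ?e) else 0)"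
    unfolding D by (simp add: action.act_scale[OF KG_scaffold_op] action.act_0[OF KG_scaffold_op])
  also have "\<dots> = (if \<forall>s<Suc i. a s \<le> e s then
      \<iota> (\<Prod>s<Suc i. \<alpha> (n - s) ^ a s) * basis (\<lambda>s. if s < Suc i then e s - a s else e s) else 0)"
  proof (cases "a i \<le> e i")
    case True
    have e: "\<forall>t\<le>n. ?e t < p"
      using Suc.prems(2) by (auto intro: order.strict_trans1)
    have IH: "act \<iota> (scaffold_op i) (basis ?e) =
       (if \<forall>s<i. a s \<le> ?e s then \<iota> (\<Prod>s<i. \<alpha> (n - s) ^ a s) * basis (\<lambda>s. if s < i then ?e s - a s else ?e s) else 0)"
      by (rule Suc.IH[OF _ e]) (use Suc.prems(1) in simp)
    have eq: "(\<lambda>s. if s < i then ?e s - a s else ?e s) = (\<lambda>s. if s < Suc i then e s - a s else e s)"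
      by (auto simp: fun_eq_iff less_Suc_eq)
    have iff: "(\<forall>s<i. a s \<le> ?e s) \<longleftrightarrow> (\<forall>s<Suc i. a s \<le> e s)"
      using True by (auto simp: less_Suc_eq)
    have prod: "\<iota> (\<Prod>s<Suc i. \<alpha> (n - s) ^ a s) = \<iota> ?c * \<iota> (\<Prod>s<i. \<alpha> (n - s) ^ a s)"
      by (simp add: hom.hom_mult mult.commute)
    show ?thesis
      unfolding if_P[OF True] IH eq iff prod
      by (simp only: if_distrib[of "times (\<iota> ?c)"] mult_zero_right mult.assoc)
  qed auto
  finally show ?case .
qed

context
  assumes \<alpha>_nonzero: "\<And>j. j \<le> n \<Longrightarrow> \<alpha> j \<noteq> 0"
    and v_\<alpha>: "\<And>j. j \<le> n \<Longrightarrow> real_of_int (vK (\<alpha> j)) =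
      real p powi (int n - int j - 1) * (\<Sum>i=j+1..n. real p ^ i * real_of_int (m_gap \<Omega> i))"
begin

text \<open>For \<open>j = n\<close> the exponent of p in the hypothesis is -1, hence
  \<open>powi\<close>. The factor p^(n+1) from [L : K] raises the exponent to (n - j) + n, and the
  identity moves from the reals to the integers.\<close>

lemma vL_\<alpha>:
  assumes "j \<le> n"
  shows "vL (\<iota> (\<alpha> j)) = int p ^ (n - j) * (lower_break n - lower_break j)"
proof -
  define S where "S = (\<Sum>i=j+1..n. int p ^ i * m_gap \<Omega> i)"
  have p0: "real p \<noteq> 0"
    using K.p_gt_1 by simp
  have "(\<Sum>k=1..n. int p ^ k * m_gap \<Omega> k) = (\<Sum>k=1..j. int p ^ k * m_gap \<Omega> k) + S"
    using sum.ub_add_nat[of 1 j "\<lambda>k. int p ^ k * m_gap \<Omega> k" "n - j"] assms by (simp add: S_def)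
  then have lb: "lower_break n - lower_break j = int p ^ n * S"
    by (simp add: lower_break_def algebra_simps)
  have "real p ^ (n + 1) * real p powi (int n - int j - 1) = real p powi (int (n + 1) + (int n - int j - 1))"
    using p0 by (subst power_int_add) (auto simp del: of_nat_Suc)
  also have "int (n + 1) + (int n - int j - 1) = int ((n - j) + n)"
    using assms by simp
  finally have pw: "real p ^ (n + 1) * real p powi (int n - int j - 1) = real p ^ ((n - j) + n)"
    by (simp only: power_int_of_nat)
  have "real_of_int (vL (\<iota> (\<alpha> j))) = real p ^ (n + 1) * (real p powi (int n - int j - 1) * real_of_int S)"
    using vL_\<iota>[OF \<alpha>_nonzero[OF assms]] v_\<alpha>[OF assms] by (simp add: S_def)
  also have "\<dots> = real p ^ ((n - j) + n) * real_of_int S"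
    by (simp only: mult.assoc[symmetric] pw)
  also have "\<dots> = real_of_int (int p ^ (n - j) * (int p ^ n * S))"
    by (simp add: power_add)
  finally show ?thesis
    unfolding lb by (simp only: of_int_eq_iff)
qed

abbreviation gain_total :: int where
  "gain_total \<equiv> \<Sum>s\<le>n. int (a s) * int p ^ s * lower_break n"

text \<open>In coordinate \<open>s\<close>, lowering the exponent by \<open>a s\<close> gains a_s
  p^s b_{n-s}, and the power of \<alpha>_{n-s} supplies a_s p^s (b_n - b_{n-s}). The total does not
  depend on the basis vector.\<close>

lemma v_act_scaffold_op:
  assumes e: "\<forall>t\<le>n. e t < p" and le: "\<forall>s\<le>n. a s \<le> e s"
  shows "act \<iota> (scaffold_op (n + 1)) (basis e) \<noteq> 0"
    "vL (act \<iota> (scaffold_op (n + 1)) (basis e)) = vL (basis e) + gain_total"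
proof -
  let ?e = "\<lambda>s. if s < n + 1 then e s - a s else e s"
  let ?A = "\<Prod>s<n + 1. \<alpha> (n - s) ^ a s"
  have eq: "act \<iota> (scaffold_op (n + 1)) (basis e) = \<iota> ?A * basis ?e"
    using act_scaffold_op[of "n + 1" e] e le by simp
  have "e s - a s < p" if "s \<le> n" for s
    using e that le_less_trans[OF diff_le_self] by blast
  then have b: "basis ?e \<noteq> 0" "vL (basis ?e) = - (\<Sum>s\<le>n. int (e s - a s) * int p ^ s * lower_break (n - s))"
    using v_basis[of ?e] by simp_all
  have A: "\<iota> ?A \<noteq> 0"
    using \<alpha>_nonzero by simp
  have "vL (\<iota> ?A) = (\<Sum>s<n + 1. vL (\<iota> (\<alpha> (n - s)) ^ a s))"
    using \<alpha>_nonzero by (simp only: hom.hom_prod hom.hom_power) (intro vL.v_prod, simp)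
  also have "\<dots> = (\<Sum>s\<le>n. int (a s) * (int p ^ s * (lower_break n - lower_break (n - s))))"
    using \<alpha>_nonzero by (intro sum.cong) (auto simp: vL.v_power vL_\<alpha>)
  finally have vA: "vL (\<iota> ?A) = (\<Sum>s\<le>n. int (a s) * (int p ^ s * (lower_break n - lower_break (n - s))))" .
  have "vL (\<iota> ?A) + vL (basis ?e) = (\<Sum>s\<le>n. int (a s) * (int p ^ s * (lower_break n - lower_break (n - s)))
      - int (e s - a s) * int p ^ s * lower_break (n - s))"
    unfolding vA b(2) by (simp add: sum_subtractf)
  also have "\<dots> = (\<Sum>s\<le>n. int (a s) * int p ^ s * lower_break n - int (e s) * int p ^ s * lower_break (n - s))"
    using le by (intro sum.cong) (auto simp: of_nat_diff algebra_simps)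
  also have "\<dots> = gain_total + vL (basis e)"
    using v_basis(2)[of e] e by (simp add: sum_subtractf)
  finally show "vL (act \<iota> (scaffold_op (n + 1)) (basis e)) = vL (basis e) + gain_total"
    unfolding eq vL.v_mult[OF A b(1)] by (simp only: add.commute)
  show "act \<iota> (scaffold_op (n + 1)) (basis e) \<noteq> 0"
    unfolding eq using A b(1) by simp
qed

text \<open>Each basis vector is killed or gains exactly \<open>gain_total\<close>, so the leading
  term stays strictly dominant if it survives. It does: its number m satisfies - m b = b modulo the
  degree, so m + 1 is divisible by the degree and all digits of m are p - 1.\<close>

lemma scaffold:
  assumes a: "\<And>s. s \<le> n \<Longrightarrow> a s \<le> p - 1" and \<rho>: "\<rho> \<noteq> 0" "[vL \<rho> = lower_break n] (mod int deg)"
  shows "act \<iota> (scaffold_op (n + 1)) \<rho> \<noteq> 0"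
    "vL (act \<iota> (scaffold_op (n + 1)) \<rho>) = vL \<rho> + gain_total"
proof -
  let ?B = "\<lambda>N. basis (digit N)" and ?F = "act \<iota> (scaffold_op (n + 1))"
  have B: "?B N \<noteq> 0" for N
    using v_basis(1) digit_less by simp
  obtain c m where c: "\<rho> = (\<Sum>N<deg. \<iota> (c N) * ?B N)" "m < deg" "c m \<noteq> 0"
    "vL (\<iota> (c m) * ?B m) = vL \<rho>"
    "\<And>N. N < deg \<Longrightarrow> N \<noteq> m \<Longrightarrow> c N \<noteq> 0 \<Longrightarrow> vL \<rho> < vL (\<iota> (c N) * ?B N)"
    "[vL \<rho> = vL (?B m)] (mod int deg)"
    using expansion[of ?B \<rho>] B basis_distinct \<rho>(1) by blast
  have sum: "?F \<rho> = (\<Sum>N<deg. \<iota> (c N) * ?F (?B N))"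
    unfolding c(1) by (rule action.act_linear[OF KG_scaffold_op])
  have vF: "?F (?B N) \<noteq> 0 \<Longrightarrow> vL (?F (?B N)) = vL (?B N) + gain_total" for N
    using act_scaffold_op[of "n + 1" "digit N"] v_act_scaffold_op(2)[of "digit N"] digit_less
    by (auto simp: less_Suc_eq_le split: if_splits)
  have vt: "vL (\<iota> (c N) * ?F (?B N)) = vL (\<iota> (c N) * ?B N) + gain_total" if "\<iota> (c N) * ?F (?B N) \<noteq> 0" for N
    using that vF[of N] B[of N] by (simp add: vL.v_mult)
  have "[- (int m * b) = b] (mod int deg)"
  proof -
    have "[- (int m * b) = vL (?B m)] (mod int deg)"
      using v_basis_cong[OF c(2)] by (rule cong_sym)
    also have "[vL (?B m) = vL \<rho>] (mod int deg)"
      using c(6) by (rule cong_sym)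
    also note \<rho>(2)
    also have "[lower_break n = b] (mod int deg)"
      using lower_break_cong by (simp add: deg_def)
    finally show ?thesis .
  qed
  then have "int deg dvd - (int m * b) - b"
    by (simp only: cong_iff_dvd_diff)
  also have "- (int m * b) - b = - (int (m + 1) * b)"
    by (simp add: algebra_simps)
  finally have "int deg dvd int (m + 1) * b"
    by (simp only: dvd_minus_iff)
  moreover have "coprime (int deg) b"
    using b_coprime by (simp add: deg_def coprime_commute)
  ultimately have "int deg dvd int (m + 1)"
    by (simp only: coprime_dvd_mult_left_iff)
  then have "deg dvd m + 1"
    by (simp only: of_nat_dvd_iff)
  then have "digit m s = p - 1" if "s \<le> n" for s
    using top_digits[OF _ c(2) that] by simp
  then have "?F (?B m) \<noteq> 0"
    using a digit_less K.p_gt_1 by (intro v_act_scaffold_op) auto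
  then have m: "\<iota> (c m) * ?F (?B m) \<noteq> 0"
    using c(3) by simp
  have less: "vL (\<iota> (c m) * ?F (?B m)) < vL (\<iota> (c N) * ?F (?B N))"
    if "N \<in> {..<deg}" "N \<noteq> m" "\<iota> (c N) * ?F (?B N) \<noteq> 0" for N
    unfolding vt[OF m] vt[OF that(3)] using c(5)[of N] c(4) that by auto
  show "?F \<rho> \<noteq> 0" "vL (?F \<rho>) = vL \<rho> + gain_total"
    unfolding sum using vL.sum_dominant[of "{..<deg}" m "\<lambda>N. \<iota> (c N) * ?F (?B N)", OF _ _ m less] c(2,4) vt[OF m]
    by simp_all
qed

end

end

end

theorem theorem1p1:
  fixes p n :: nat
    and \<iota> :: "'k::field fls \<Rightarrow> 'l::field"
    and vL :: "'l \<Rightarrow> int"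
    and x :: "nat \<Rightarrow> 'l"
    and \<beta> :: "'k fls"
    and b bm :: int
    and \<Omega> \<epsilon> \<alpha> :: "nat \<Rightarrow> 'k fls"
    and \<sigma> :: "nat \<Rightarrow> 'l field_auto"
    and \<pi> \<rho> :: 'l
    and a :: "nat \<Rightarrow> nat"
  assumes "prime p"
    and "is_finite_field_of_char p TYPE('k) \<or> is_Fp_bar p TYPE('k)"
    and "near_one_dimensional p n \<iota> vL x \<beta> b \<Omega> \<epsilon>"
    and "\<And>i. i \<le> n \<Longrightarrow> \<sigma> i \<in> galois_group \<iota>"
    and "\<And>i. i \<le> n \<Longrightarrow> app (\<sigma> i) (x i) = x i + 1"
    and "\<And>i j. i \<le> n \<Longrightarrow> j \<le> n \<Longrightarrow> j \<noteq> i \<Longrightarrow> app (\<sigma> i) (x j) = x j"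
    and "\<And>j. j \<le> n \<Longrightarrow> \<alpha> j \<noteq> 0"
    and "\<And>j. j \<le> n \<Longrightarrow>
           real_of_int (fls_subdegree (\<alpha> j)) =
             real p powi (int n - int j - 1) * (\<Sum>i=j+1..n. real p ^ i * real_of_int (m_gap \<Omega> i))"
    and "is_uniformizer vL \<pi>"
    and "is_largest_lower_break \<iota> vL \<pi> bm"
    and "\<rho> \<noteq> 0"
    and "[vL \<rho> = bm] (mod int (p ^ (n + 1)))"
    and "\<And>s. s \<le> n \<Longrightarrow> a s \<in> {0..p - 1}"
  defines "\<eta> \<equiv> act \<iota> (prod_list (map (\<lambda>s. scalar (\<alpha> (n - s) ^ a s) *
                                          (Theta p n \<Omega> \<sigma> s - 1) ^ a s) [0..<n + 1])) \<rho>"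
  shows "\<eta> \<noteq> 0 \<and> vL \<eta> = vL \<rho> + (\<Sum>s=0..n. int (a s) * int p ^ s * bm)"
proof -
  have char: "CHAR('k) = p"
    using assms(2) by (auto simp: is_finite_field_of_char_def is_Fp_bar_def)
  interpret near_one_dim_galois p n \<iota> vL x \<beta> b \<Omega> \<epsilon> \<sigma>
    using assms(1,3-6) char
    by (simp add: near_one_dim_galois_def near_one_dim_def near_one_dim_axioms_def near_one_dim_galois_axioms_def)
  have bm: "bm = lower_break n"
    using largest_lower_break_unique[of "\<sigma> n" \<pi> bm] assms(4-6,9,10) by simp
  have \<rho>: "[vL \<rho> = lower_break n] (mod int deg)"
    using assms(12) by (simp add: bm deg_def)
  have a: "a s \<le> p - 1" if "s \<le> n" for s
    using assms(13)[OF that] by simp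
  have "\<eta> = act \<iota> (scaffold_op \<alpha> a (n + 1)) \<rho>"
    by (simp only: \<eta>_def scaffold_op_def)
  then show ?thesis
    using scaffold[OF assms(7,8) a assms(11) \<rho>] by (simp add: bm atLeast0AtMost)
qed

end
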